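(* Let $F:\mathbb{R}^3\to\mathbb{R}$ be continuous and satisfy $$F(0,0,0)=F(x,0,0)=F(0,y,0)=F(0,0,z)=0$$ for all $x,y,z$, along with $$\Delta_3(F;a,b,c,d',e,e')\ge0$$ for all rectangles $\{(x,y,z):a\le x\le b,\ c\le y\le d',\ e\le z\le e'\}$. Then, for any nonnegative measurable functions $f,g,h$ on $\mathbb{R}^d$ with finite distribution functions, $$\iint F(f(s),g(t),h(s+t))\,ds\,dt\le\iint F(f^*(s),g^*(t),h^*(s+t))\,ds\,dt,$$ where the integrals are over $\mathbb{R}^d\times\mathbb{R}^d$.
   Context: For $F:\mathbb{R}^3\to\mathbb{R}$, $$\Delta_3(F;a,b,c,d',e,e')=F(b,d',e')-F(a,d',e')-F(b,c,e')-F(b,d',e)+F(b,c,e)+F(a,d',e)+F(a,c,e')-F(a,c,e).$$ For nonnegative measurable $f$ on $\mathbb{R}^d$, its distribution function is $\lambda\mapsto|\{x\in\mathbb{R}^d:f(x)\ge\lambda\}|$ (Lebesgue measure); $f$ has finite distribution function if this is finite for all $\lambda>0$. In that case $f^*$ denotes the symmetric decreasing rearrangement of $f$: the unique lower semicontinuous function on $\mathbb{R}^d$ which is radially symmetric and nonincreasing (in $|x|$) and has the same distribution function as $f$.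
   Formalization: It is additionally assumed that the negative parts of F(f(s),g(t),0), F(f(s),0,h(s+t)) and F(0,g(t),h(s+t)) have finite integral over R^d×R^d (automatic if F≥0); without such a condition the inequality can fail even when both integrals converge absolutely. *)

theory Defs
  imports "HOL-Analysis.Analysis"
begin

definition Delta3 ::
  "(real \<times> real \<times> real \<Rightarrow> real) \<Rightarrow> real \<Rightarrow> real \<Rightarrow> real \<Rightarrow> real \<Rightarrow> real \<Rightarrow> real \<Rightarrow> real" where
  "Delta3 F a b c d' e e' =
     F (b, d', e') - F (a, d', e') - F (b, c, e') - F (b, d', e)
     + F (b, c, e) + F (a, d', e) + F (a, c, e') - F (a, c, e)"

definition distribution_function :: "('a::euclidean_space \<Rightarrow> ennreal) \<Rightarrow> real \<Rightarrow> ennreal" where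
  "distribution_function u l = emeasure lebesgue {x. ennreal l \<le> u x}"

definition finite_distribution_function :: "('a::euclidean_space \<Rightarrow> real) \<Rightarrow> bool" where
  "finite_distribution_function f \<longleftrightarrow>
     (\<forall>l>0. distribution_function (\<lambda>x. ennreal (f x)) l < \<infinity>)"

text \<open>
  The rearrangement takes values in \<^typ>\<open>ennreal\<close>: for an unbounded function, lower
  semicontinuity and monotonicity force the value \<open>\<infinity>\<close> at the origin. It is finite everywhere else.
\<close>

definition is_symm_decr_rearrangement ::
  "('a::euclidean_space \<Rightarrow> real) \<Rightarrow> ('a \<Rightarrow> ennreal) \<Rightarrow> bool" where
  "is_symm_decr_rearrangement f u \<longleftrightarrow>
     (\<forall>a. open {x. a < u x}) \<and>
     (\<forall>x y. norm x = norm y \<longrightarrow> u x = u y) \<and>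
     (\<forall>x y. norm x \<le> norm y \<longrightarrow> u y \<le> u x) \<and>
     (\<forall>l. distribution_function u l = distribution_function (\<lambda>x. ennreal (f x)) l)"

definition symm_decr_rearrangement :: "('a::euclidean_space \<Rightarrow> real) \<Rightarrow> 'a \<Rightarrow> ennreal" where
  "symm_decr_rearrangement f = (THE u. is_symm_decr_rearrangement f u)"

lemma is_symm_decr_rearrangement_le:
  fixes u v :: "'a::euclidean_space \<Rightarrow> ennreal"
  assumes u: "is_symm_decr_rearrangement f u" and v: "is_symm_decr_rearrangement f v"
  shows "u x \<le> v x"
proof (rule ccontr)
  have u_lsc: "open {y. a < u y}" and u_mono: "norm y \<le> norm w \<Longrightarrow> u w \<le> u y" for a w y
    using u unfolding is_symm_decr_rearrangement_def by blast+
  have v_mono: "norm y \<le> norm w \<Longrightarrow> v w \<le> v y" for w y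
    using v unfolding is_symm_decr_rearrangement_def by blast
  have uv: "distribution_function u l = distribution_function v l" for l
    using u v unfolding is_symm_decr_rearrangement_def by metis
  define c where "c = unit_ball_vol (real DIM('a))"
  have c: "0 < c" by (simp add: c_def)
  assume "\<not> u x \<le> v x"
  then obtain z where z: "v x < z" "z < u x" using dense[of "v x" "u x"] by (auto simp: not_le)
  then obtain l where l: "0 \<le> l" "z = ennreal l" by (cases z) auto
  obtain e where e: "0 < e" "cball x e \<subseteq> {y. z < u y}"
    using u_lsc[of z] z by (auto simp: open_contains_cball)
  obtain y where y: "y \<in> cball x e" "norm x < norm y"
  proof (cases "x = 0")
    case True
    obtain b :: 'a where "b \<in> Basis" using nonempty_Basis by blast
    then show ?thesis using that[of "e *\<^sub>R b"] e True by (auto simp: dist_norm)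
  next
    case False
    have eq: "x + (e / norm x) *\<^sub>R x = (1 + e / norm x) *\<^sub>R x" by (simp add: scaleR_add_left)
    have "norm (x + (e / norm x) *\<^sub>R x) = norm x + e"
      unfolding eq norm_scaleR using e False by (simp add: field_simps)
    then show ?thesis using that[of "x + (e / norm x) *\<^sub>R x"] e False by (auto simp: dist_norm)
  qed
  have zy: "z < u y" using y e by auto
  have 1: "ball 0 (norm y) \<subseteq> {w. z \<le> u w}"
  proof
    fix w :: 'a assume "w \<in> ball 0 (norm y)"
    then have "u y \<le> u w" using u_mono by auto
    then show "w \<in> {w. z \<le> u w}" using zy by auto
  qed
  have 2: "{w. z \<le> v w} \<subseteq> ball 0 (norm x)"
  proof
    fix w :: 'a assume "w \<in> {w. z \<le> v w}"
    then have "\<not> v w \<le> v x" using z by auto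
    then have "\<not> norm x \<le> norm w" using v_mono by blast
    then show "w \<in> ball 0 (norm x)" by auto
  qed
  have "u \<in> borel_measurable borel" using u_lsc by (intro borel_measurableI_greater) auto
  then have "{w \<in> space borel. z \<le> u w} \<in> sets borel" by measurable
  then have meas: "{w. z \<le> u w} \<in> sets lebesgue" by auto
  have "emeasure lebesgue (ball (0::'a) (norm y)) \<le> emeasure lebesgue {w. z \<le> u w}"
    using 1 meas by (rule emeasure_mono)
  also have "\<dots> = emeasure lebesgue {w. z \<le> v w}"
    using uv[of l] by (simp add: distribution_function_def l)
  also have "\<dots> \<le> emeasure lebesgue (ball (0::'a) (norm x))"
    using 2 by (rule emeasure_mono) auto
  finally have "c * norm y ^ DIM('a) \<le> c * norm x ^ DIM('a)"
    using c by (simp add: emeasure_ball c_def[symmetric] ennreal_le_iff)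
  then show False using c y by (simp add: power_mono_iff)
qed

lemma is_symm_decr_rearrangement_exists:
  fixes f :: "'a::euclidean_space \<Rightarrow> real"
  assumes f: "f \<in> borel_measurable lebesgue" and fin: "finite_distribution_function f"
  shows "\<exists>u. is_symm_decr_rearrangement f u"
proof -
  define c where "c = unit_ball_vol (real DIM('a))"
  have c: "0 < c" by (simp add: c_def)
  define V where "V = (\<lambda>x::'a. ennreal (c * norm x ^ DIM('a)))"
  define N where "N = distribution_function (\<lambda>x. ennreal (f x))"
  define u where "u = (\<lambda>x. SUP l\<in>{l. 0 < l \<and> V x < N l}. ennreal l)"
  have sets_f: "{x. ennreal l \<le> ennreal (f x)} \<in> sets lebesgue" for l
  proof -
    have "(\<lambda>x. ennreal (f x)) \<in> borel_measurable lebesgue" using f by measurable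
    then have "{x \<in> space lebesgue. ennreal l \<le> ennreal (f x)} \<in> sets lebesgue" by measurable
    then show ?thesis by simp
  qed
  have N_anti: "N m \<le> N l" if "l \<le> m" for l m
    unfolding N_def distribution_function_def
    using that sets_f by (intro emeasure_mono) (auto intro: order_trans ennreal_leI)
  have N_fin: "N l < \<infinity>" if "0 < l" for l
    using fin that by (auto simp: finite_distribution_function_def N_def)
  have V_mono: "V x \<le> V y" if "norm x \<le> norm y" for x y
    unfolding V_def using that c by (intro ennreal_leI mult_left_mono power_mono) auto
  have V_cont: "continuous_on UNIV V"
    unfolding V_def by (intro continuous_on_ennreal continuous_intros)
  have mono: "u y \<le> u x" if "norm x \<le> norm y" for x y
    unfolding u_def using V_mono[OF that] by (intro SUP_subset_mono) (auto intro: le_less_trans)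
  have lsc: "open {x. a < u x}" for a
  proof -
    have "{x. a < u x} = (\<Union>l\<in>{l. 0 < l \<and> a < ennreal l}. {x. V x < N l})"
      by (auto simp: u_def less_SUP_iff)
    moreover have "open {x. V x < N l}" for l
      by (intro open_Collect_less V_cont continuous_intros)
    ultimately show ?thesis by auto
  qed
  have meas_lt: "emeasure lebesgue {x. V x < m} = m"
    and meas_le: "emeasure lebesgue {x. V x \<le> m} = m" if m: "m < \<infinity>" for m
  proof -
    obtain q where q: "0 \<le> q" "m = ennreal q" using m by (cases m) auto
    define r where "r = root DIM('a) (q / c)"
    have r: "0 \<le> r" "c * r ^ DIM('a) = q" using c q by (auto simp: r_def)
    have iff: "norm x ^ DIM('a) < r ^ DIM('a) \<longleftrightarrow> norm x < r"
      "norm x ^ DIM('a) \<le> r ^ DIM('a) \<longleftrightarrow> norm x \<le> r" for x :: 'a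
      using r(1) by (simp_all add: linorder_not_le[symmetric])
    have V_m: "V x < m \<longleftrightarrow> norm x < r" "V x \<le> m \<longleftrightarrow> norm x \<le> r" for x
      unfolding V_def q(2) r(2)[symmetric] using c r(1) iff[of x]
      by (simp_all add: ennreal_less_iff)
    have "{x. V x < m} = ball 0 r" using V_m by auto
    then show "emeasure lebesgue {x. V x < m} = m"
      using r q by (simp add: emeasure_ball c_def[symmetric])
    have "{x. V x \<le> m} = cball 0 r" using V_m by auto
    then show "emeasure lebesgue {x. V x \<le> m} = m"
      using r q by (simp add: emeasure_cball c_def[symmetric])
  qed
  have dist: "distribution_function u l = N l" for l
  proof (cases "0 < l")
    case False
    then have "ennreal l = 0" by (auto simp: ennreal_neg)
    then show ?thesis by (simp add: N_def distribution_function_def)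
  next
    case True
    define s where "s = (\<lambda>k::nat. l - l / (real k + 2))"
    have s: "0 < s k" "s k < l" for k
      using True by (auto simp: s_def field_simps intro: add_pos_nonneg)
    have "(\<lambda>k. l / real (k + 2)) \<longlonglongrightarrow> 0"
      by (rule LIMSEQ_ignore_initial_segment[OF lim_const_over_n])
    from tendsto_diff[OF tendsto_const[of l] this] have s_lim: "s \<longlonglongrightarrow> l"
      by (simp add: s_def add.commute)
    have s_mono: "s j \<le> s k" if "j \<le> k" for j k
      unfolding s_def using that True by (intro diff_left_mono divide_left_mono) auto
    have Inter: "(\<Inter>k. {x. ennreal (s k) \<le> ennreal (f x)}) = {x. ennreal l \<le> ennreal (f x)}"
    proof (intro equalityI subsetI)
      fix x assume "x \<in> (\<Inter>k. {x. ennreal (s k) \<le> ennreal (f x)})"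
      then have "s k \<le> f x" for k
        using s(1)[of k] by (force simp: ennreal_le_iff2)
      then have "l \<le> f x" using s_lim LIMSEQ_le_const2 by blast
      then show "x \<in> {x. ennreal l \<le> ennreal (f x)}" by (auto intro: ennreal_leI)
    next
      fix x assume "x \<in> {x. ennreal l \<le> ennreal (f x)}"
      then show "x \<in> (\<Inter>k. {x. ennreal (s k) \<le> ennreal (f x)})"
        using s by (auto intro: order_trans[OF ennreal_leI[OF less_imp_le]])
    qed
    have "(\<lambda>k. emeasure lebesgue {x. ennreal (s k) \<le> ennreal (f x)})
       \<longlonglongrightarrow> emeasure lebesgue (\<Inter>k. {x. ennreal (s k) \<le> ennreal (f x)})"
    proof (rule Lim_emeasure_decseq)
      show "range (\<lambda>k. {x. ennreal (s k) \<le> ennreal (f x)}) \<subseteq> sets lebesgue" using sets_f by auto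
      show "decseq (\<lambda>k. {x. ennreal (s k) \<le> ennreal (f x)})"
        using s_mono by (auto simp: decseq_def intro: order_trans[OF ennreal_leI])
      show "emeasure lebesgue {x. ennreal (s k) \<le> ennreal (f x)} \<noteq> \<infinity>" for k
        using N_fin[OF s(1)[of k]] by (auto simp: N_def distribution_function_def)
    qed
    then have N_lim: "(\<lambda>k. N (s k)) \<longlonglongrightarrow> N l"
      unfolding Inter by (simp add: N_def distribution_function_def)
    have lower: "{x. V x < N l} \<subseteq> {x. ennreal l \<le> u x}"
      using True by (auto simp: u_def intro!: SUP_upper)
    have upper: "{x. ennreal l \<le> u x} \<subseteq> {x. V x \<le> N l}"
    proof
      fix x assume x: "x \<in> {x. ennreal l \<le> u x}"
      have "V x \<le> N (s k)" for k
      proof -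
        have "ennreal (s k) < ennreal l" using s True by (simp add: ennreal_lessI)
        then have "ennreal (s k) < u x" using x by auto
        then obtain m where m: "V x < N m" "ennreal (s k) < ennreal m"
          by (auto simp: u_def less_SUP_iff)
        then have "s k \<le> m" using s(1)[of k] by (metis ennreal_leI leD nle_le)
        then show ?thesis using N_anti m by (meson less_le_trans less_imp_le)
      qed
      then show "x \<in> {x. V x \<le> N l}" using N_lim LIMSEQ_le_const by blast
    qed
    have "u \<in> borel_measurable borel" using lsc by (intro borel_measurableI_greater) auto
    then have "{w \<in> space borel. ennreal l \<le> u w} \<in> sets borel" by measurable
    then have mu: "{w. ennreal l \<le> u w} \<in> sets lebesgue" by auto
    have "closed {x. V x \<le> N l}" by (intro closed_Collect_le V_cont continuous_intros)
    then have mV: "{x. V x \<le> N l} \<in> sets lebesgue" by auto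
    have "N l \<le> emeasure lebesgue {x. ennreal l \<le> u x}"
      using emeasure_mono[OF lower mu] meas_lt[OF N_fin[OF True]] by simp
    moreover have "emeasure lebesgue {x. ennreal l \<le> u x} \<le> N l"
      using emeasure_mono[OF upper mV] meas_le[OF N_fin[OF True]] by simp
    ultimately show ?thesis by (simp add: distribution_function_def)
  qed
  have "is_symm_decr_rearrangement f u"
    unfolding is_symm_decr_rearrangement_def
    using lsc mono dist by (auto simp: N_def intro: antisym)
  then show ?thesis by blast
qed

theorem is_symm_decr_rearrangement_symm_decr_rearrangement:
  assumes "f \<in> borel_measurable lebesgue" and "finite_distribution_function f"
  shows "is_symm_decr_rearrangement f (symm_decr_rearrangement f)"
proof -
  have "\<exists>!u. is_symm_decr_rearrangement f u"
    using is_symm_decr_rearrangement_exists[OF assms]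
    by (metis antisym ext is_symm_decr_rearrangement_le)
  then show ?thesis unfolding symm_decr_rearrangement_def by (rule theI')
qed

text \<open>
  The Lebesgue integral of a real function as an extended real. It is meaningful only if the
  positive or the negative part has finite integral, because \<open>\<infinity> - \<infinity> = \<infinity>\<close> in \<^typ>\<open>ereal\<close>.
\<close>

definition ext_integral :: "'b measure \<Rightarrow> ('b \<Rightarrow> real) \<Rightarrow> ereal" where
  "ext_integral M k =
     enn2ereal (\<integral>\<^sup>+ p. ennreal (k p) \<partial>M) - enn2ereal (\<integral>\<^sup>+ p. ennreal (- k p) \<partial>M)"

text \<open>
  The condition under which the integrals of \<open>F (f s, g t, h (s + t))\<close> and of its rearranged
  counterpart are well defined in \<open>(-\<infinity>, \<infinity>]\<close>. With the vanishing of \<open>F\<close> on the axes,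
  \<open>F (x, y, z) = Delta3 F 0 x 0 y 0 z + F (x, y, 0) + F (x, 0, z) + F (0, y, z)\<close>,
  and the first summand is nonnegative for \<open>x, y, z \<ge> 0\<close>. The integrals of the other three depend
  only on the distribution functions, so the condition passes to the rearrangements.
  It is automatic if \<open>F \<ge> 0\<close>. For signed \<open>F\<close>, absolute convergence of the two integrals to be
  compared would not be enough: cancellation among the last three summands can then
  reverse the inequality, even when the first summand vanishes.
\<close>

definition boundary_terms_integrable_below ::
  "(real \<times> real \<times> real \<Rightarrow> real) \<Rightarrow> ('a::euclidean_space \<Rightarrow> real) \<Rightarrow> ('a \<Rightarrow> real) \<Rightarrow> ('a \<Rightarrow> real) \<Rightarrow> bool"
  where
  "boundary_terms_integrable_below F f g h \<longleftrightarrow>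
     (\<integral>\<^sup>+ (s, t). ennreal (- F (f s, g t, 0)) \<partial>(lebesgue :: ('a \<times> 'a) measure)) < \<infinity> \<and>
     (\<integral>\<^sup>+ (s, t). ennreal (- F (f s, 0, h (s + t))) \<partial>(lebesgue :: ('a \<times> 'a) measure)) < \<infinity> \<and>
     (\<integral>\<^sup>+ (s, t). ennreal (- F (0, g t, h (s + t))) \<partial>(lebesgue :: ('a \<times> 'a) measure)) < \<infinity>"

end

theory Submission
  imports Defs
begin

text \<open>
  For sets \<open>A, B, C\<close> of finite measure on the line, choose \<open>a\<close> and \<open>b\<close> such that
  \<open>A \<inter> {..a}\<close> and \<open>B \<inter> {b<..}\<close> both have measure \<open>t\<close>. For fixed \<open>x\<close> the \<open>s \<in> A\<close> with
  \<open>x - s \<in> B\<close> and (\<open>s \<le> a\<close> or \<open>b < x - s\<close>) have measure at most \<open>t\<close>, so that the pairs in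
  \<open>A \<times> B\<close> with sum in \<open>C\<close> have measure at most \<open>t |C| + (|A| - t) (|B| - t)\<close>; the right choice
  of \<open>t\<close> makes this an equality for centred intervals. Fubini along a direction \<open>v\<close> then shows
  that Steiner symmetrization does not decrease the triple integral of three sets. If a set
  differs from the centred ball of its measure, averaging over \<open>v\<close> produces a direction for which
  symmetrization increases the overlap with that ball by a definite amount, so triples close
  to balls are reached and Riesz's inequality for sets follows by continuity.

  The mixed difference \<open>Delta3 F 0 x 0 y 0 z\<close> is a limit of nonnegative combinations of
  indicators of superlevel sets, so its integral does not decrease under rearrangement, while
  the boundary terms of \<open>F\<close> depend only on the distribution functions.
\<close>

subsection \<open>The sets of pairs with prescribed summands and sum\<close>

text \<open>Iterated symmetrizations need not converge for an arbitrary choice of directions, and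
  the proof constructs no limit set. What replaces convergence is uniformity: a defect
  \<open>d\<close> yields a gain \<open>d^2 / (2 V)\<close>, where \<open>V\<close> is the volume of
  a ball fixed once and for all. A supremum below the total volume would thus be exceeded by one
  more step from a nearly optimal triple. A nearly optimal triple is enough, since the measure of
  \<open>tri\<close> changes by at most a constant times the measures of the set differences. The
  gain comes from using one vector twice. Translation by \<open>v\<close> carries a part of
  \<open>A\<close> outside the ball onto points of the ball missing from \<open>A\<close>; both lie
  on the same line in direction \<open>v\<close>. On that line the overlap is therefore smaller than
  both chord lengths, while symmetrization raises it to the smaller of the two. For functions, two
  infinities need care: \<open>f*\<close> may be infinite at the origin, a null set, and integrals
  of positive parts may be infinite, so sums of signed integrals are formed only with finite
  negative parts.\<close>

definition tri :: "'a::euclidean_space set \<Rightarrow> 'a set \<Rightarrow> 'a set \<Rightarrow> ('a \<times> 'a) set" where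
  "tri A B C = {(s, t). s \<in> A \<and> t \<in> B \<and> s + t \<in> C}"

lemma tri_sets [measurable]:
  fixes A B C :: "'a::euclidean_space set"
  assumes [measurable]: "A \<in> sets borel" "B \<in> sets borel" "C \<in> sets borel"
  shows "tri A B C \<in> sets borel"
proof -
  have "{p \<in> space (borel :: ('a \<times> 'a) measure). fst p \<in> A \<and> snd p \<in> B \<and> fst p + snd p \<in> C} \<in> sets borel"
    unfolding borel_prod[symmetric] by measurable
  then show ?thesis by (auto simp: tri_def case_prod_unfold)
qed

section \<open>Iterated integrals, translations and reflections\<close>

lemma nn_integral_lborel_pair:
  fixes f :: "'a::euclidean_space \<times> 'b::euclidean_space \<Rightarrow> ennreal"
  assumes [measurable]: "f \<in> borel_measurable borel"
  shows "(\<integral>\<^sup>+p. f p \<partial>lborel) = (\<integral>\<^sup>+s. \<integral>\<^sup>+t. f (s, t) \<partial>lborel \<partial>lborel)"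
proof -
  have "f \<in> borel_measurable (lborel \<Otimes>\<^sub>M lborel)"
    unfolding lborel_prod by simp
  from lborel.nn_integral_fst[OF this] show ?thesis by (simp add: lborel_prod)
qed

lemma nn_integral_lborel_swap:
  fixes f :: "'a::euclidean_space \<Rightarrow> 'b::euclidean_space \<Rightarrow> ennreal"
  assumes "(\<lambda>(s, t). f s t) \<in> borel_measurable (borel \<Otimes>\<^sub>M borel)"
  shows "(\<integral>\<^sup>+s. \<integral>\<^sup>+t. f s t \<partial>lborel \<partial>lborel) = (\<integral>\<^sup>+t. \<integral>\<^sup>+s. f s t \<partial>lborel \<partial>lborel)"
proof -
  have "(\<lambda>(s, t). f s t) \<in> borel_measurable (lborel \<Otimes>\<^sub>M lborel)"
    using assms by (simp cong: measurable_cong_sets)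
  from lborel_pair.Fubini'[OF this] show ?thesis by simp
qed

lemma nn_integral_lborel_translate:
  fixes f :: "'a::euclidean_space \<Rightarrow> ennreal"
  assumes [measurable]: "f \<in> borel_measurable borel"
  shows "(\<integral>\<^sup>+x. f (a + x) \<partial>lborel) = (\<integral>\<^sup>+x. f x \<partial>lborel)"
proof -
  have "(\<integral>\<^sup>+x. f x \<partial>lborel) = (\<integral>\<^sup>+x. f x \<partial>distr lborel borel ((+) a))"
    by (simp add: lborel_distr_plus)
  also have "\<dots> = (\<integral>\<^sup>+x. f (a + x) \<partial>lborel)" by (subst nn_integral_distr) auto
  finally show ?thesis by simp
qed

lemma nn_integral_lborel_reflect:
  fixes f :: "'a::euclidean_space \<Rightarrow> ennreal"
  assumes [measurable]: "f \<in> borel_measurable borel"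
  shows "(\<integral>\<^sup>+x. f (a - x) \<partial>lborel) = (\<integral>\<^sup>+x. f x \<partial>lborel)"
proof -
  have "lborel = distr lborel borel (\<lambda>x::'a. a - x)"
    using lborel_affine[of "-1" a] by (simp add: density_1)
  then have "(\<integral>\<^sup>+x. f x \<partial>lborel) = (\<integral>\<^sup>+x. f x \<partial>distr lborel borel (\<lambda>x. a - x))" by simp
  also have "\<dots> = (\<integral>\<^sup>+x. f (a - x) \<partial>lborel)" by (subst nn_integral_distr) auto
  finally show ?thesis by simp
qed

lemma emeasure_tri:
  fixes A B C :: "'a::euclidean_space set"
  assumes [measurable]: "A \<in> sets borel" "B \<in> sets borel" "C \<in> sets borel"
  shows "emeasure lborel (tri A B C) =
    (\<integral>\<^sup>+s. \<integral>\<^sup>+t. indicator A s * indicator B t * indicator C (s + t) \<partial>lborel \<partial>lborel)"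
proof -
  have "emeasure lborel (tri A B C) = (\<integral>\<^sup>+p. indicator (tri A B C) p \<partial>lborel)"
    by simp
  also have "\<dots> = (\<integral>\<^sup>+s. \<integral>\<^sup>+t. indicator (tri A B C) (s, t) \<partial>lborel \<partial>lborel)"
    by (rule nn_integral_lborel_pair) simp
  also have "\<dots> = (\<integral>\<^sup>+s. \<integral>\<^sup>+t. indicator A s * indicator B t * indicator C (s + t) \<partial>lborel \<partial>lborel)"
    by (intro nn_integral_cong) (auto simp: tri_def indicator_def)
  finally show ?thesis .
qed

text \<open>With the sum \<open>x\<close> as a new variable, the inner measure is the convolution of
  the indicators of \<open>A\<close> and \<open>B\<close> at \<open>x\<close>. In this form a bound
  on the convolution can be integrated over \<open>C\<close>.\<close>

lemma emeasure_tri_conv: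
  fixes A B C :: "'a::euclidean_space set"
  assumes [measurable]: "A \<in> sets borel" "B \<in> sets borel" "C \<in> sets borel"
  shows "emeasure lborel (tri A B C) =
    (\<integral>\<^sup>+x. indicator C x * emeasure lborel {s \<in> A. x - s \<in> B} \<partial>lborel)"
proof -
  have [measurable]: "(\<lambda>p::'a\<times>'a. indicator B (fst p - snd p) :: ennreal) \<in> borel_measurable (borel \<Otimes>\<^sub>M borel)"
     "(\<lambda>p::'a\<times>'a. indicator B (snd p - fst p) :: ennreal) \<in> borel_measurable (borel \<Otimes>\<^sub>M borel)"
     by measurable
  \<comment> \<open>Writing \<open>t\<close> as \<open>- s + (s + t)\<close> makes the integrand,
    for fixed \<open>s\<close>, a function of \<open>s + t\<close>, to which translation invariance
    applies.\<close>
  have "emeasure lborel (tri A B C) =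
      (\<integral>\<^sup>+s. \<integral>\<^sup>+t. indicator A s * indicator B (- s + (s + t)) * indicator C (s + t) \<partial>lborel \<partial>lborel)"
    by (simp add: emeasure_tri)
  also have "\<dots> = (\<integral>\<^sup>+s. \<integral>\<^sup>+x. indicator A s * indicator B (x - s) * indicator C x \<partial>lborel \<partial>lborel)"
  proof (rule nn_integral_cong)
    fix s :: "'a"
    show "(\<integral>\<^sup>+t. indicator A s * indicator B (- s + (s + t)) * indicator C (s + t) \<partial>lborel)
        = (\<integral>\<^sup>+x. indicator A s * indicator B (x - s) * indicator C x \<partial>lborel)"
      using nn_integral_lborel_translate[of "\<lambda>x. indicator A s * indicator B (- s + x) * indicator C x" s]
      by simp
  qed
  also have "\<dots> = (\<integral>\<^sup>+x. \<integral>\<^sup>+s. indicator A s * indicator B (x - s) * indicator C x \<partial>lborel \<partial>lborel)"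
    by (rule nn_integral_lborel_swap) (simp add: case_prod_unfold)
  also have "\<dots> = (\<integral>\<^sup>+x. indicator C x * emeasure lborel {s \<in> A. x - s \<in> B} \<partial>lborel)"
  proof (intro nn_integral_cong)
    fix x
    have [measurable]: "{s \<in> A. x - s \<in> B} \<in> sets borel"
    proof -
      have "{s \<in> space borel. s \<in> A \<and> x - s \<in> B} \<in> sets borel" by measurable
      then show ?thesis by simp
    qed
    have "(\<integral>\<^sup>+s. indicator A s * indicator B (x - s) * indicator C x \<partial>lborel)
        = (\<integral>\<^sup>+s. indicator C x * indicator {s \<in> A. x - s \<in> B} s \<partial>lborel)"
      by (intro nn_integral_cong) (auto simp: indicator_def)
    also have "\<dots> = indicator C x * emeasure lborel {s \<in> A. x - s \<in> B}"
      by (subst nn_integral_cmult) auto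
    finally show "(\<integral>\<^sup>+s. indicator A s * indicator B (x - s) * indicator C x \<partial>lborel)
        = indicator C x * emeasure lborel {s \<in> A. x - s \<in> B}" .
  qed
  finally show ?thesis .
qed

lemma emeasure_vimage_translate:
  fixes A :: "'a::euclidean_space set"
  assumes [measurable]: "A \<in> sets borel"
  shows "emeasure lborel {x. a + x \<in> A} = emeasure lborel A"
proof -
  have [measurable]: "{x. a + x \<in> A} \<in> sets borel"
    using measurable_sets[of "\<lambda>x. a + x" borel borel A] by (auto simp: vimage_def)
  have "emeasure lborel {x. a + x \<in> A} = (\<integral>\<^sup>+x. indicator {x. a + x \<in> A} x \<partial>lborel)"
    by simp
  also have "\<dots> = (\<integral>\<^sup>+x. indicator A (a + x) \<partial>lborel)"
    by (intro nn_integral_cong) (auto simp: indicator_def)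
  also have "\<dots> = emeasure lborel A"
    by (subst nn_integral_lborel_translate) auto
  finally show ?thesis .
qed

lemma emeasure_vimage_reflect:
  fixes A :: "'a::euclidean_space set"
  assumes [measurable]: "A \<in> sets borel"
  shows "emeasure lborel {x. a - x \<in> A} = emeasure lborel A"
proof -
  have [measurable]: "{x. a - x \<in> A} \<in> sets borel"
    using measurable_sets[of "\<lambda>x. a - x" borel borel A] by (auto simp: vimage_def)
  have "emeasure lborel {x. a - x \<in> A} = (\<integral>\<^sup>+x. indicator {x. a - x \<in> A} x \<partial>lborel)"
    by simp
  also have "\<dots> = (\<integral>\<^sup>+x. indicator A (a - x) \<partial>lborel)"
    by (intro nn_integral_cong) (auto simp: indicator_def)
  also have "\<dots> = emeasure lborel A"
    by (subst nn_integral_lborel_reflect) auto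
  finally show ?thesis .
qed

lemma emeasure_times:
  fixes A B :: "'a::euclidean_space set"
  assumes "A \<in> sets borel" "B \<in> sets borel"
  shows "emeasure lborel (A \<times> B) = emeasure lborel A * emeasure lborel B"
  using lborel.emeasure_pair_measure_Times[of A lborel B] assms by (simp add: lborel_prod)

subsection \<open>Riesz's inequality on the real line\<close>

text \<open>The measure of \<open>A \<inter> {..x}\<close> is 1-Lipschitz in \<open>x\<close> and
  grows from 0 to the measure of \<open>A\<close>, so the intermediate value theorem
  applies.\<close>

lemma measure_atMost_quantile:
  fixes A :: "real set"
  assumes [measurable]: "A \<in> sets borel" and A: "A \<subseteq> {-R..R}" and t: "0 \<le> t" "t \<le> measure lborel A"
  shows "\<exists>a. measure lborel (A \<inter> {..a}) = t"
proof -
  define \<alpha> where "\<alpha> x = measure lborel (A \<inter> {..x})" for x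
  have fm: "S \<in> fmeasurable lborel" if [measurable]: "S \<in> sets borel" and "S \<subseteq> A" for S
    using that A by (intro fmeasurableI2[of "{-R..R}" lborel S]) (auto simp: fmeasurable_def emeasure_lborel_Icc_eq)
  have lip: "\<bar>\<alpha> y - \<alpha> x\<bar> \<le> y - x" if "x \<le> y" for x y
  proof -
    have "A \<inter> {..y} = (A \<inter> {..x}) \<union> (A \<inter> {x<..y})" using that by auto
    moreover have "measure lborel ((A \<inter> {..x}) \<union> (A \<inter> {x<..y}))
        = measure lborel (A \<inter> {..x}) + measure lborel (A \<inter> {x<..y})"
    proof (rule measure_Un_AE)
      show "AE z in lborel. z \<notin> A \<inter> {..x} \<or> z \<notin> A \<inter> {x<..y}" by auto
    qed (auto intro!: fm)
    ultimately have "\<alpha> y = \<alpha> x + measure lborel (A \<inter> {x<..y})"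
      by (simp add: \<alpha>_def)
    moreover have "measure lborel (A \<inter> {x<..y}) \<le> measure lborel {x<..y}"
      by (rule measure_mono_fmeasurable) (auto simp: fmeasurable_def that)
    ultimately show ?thesis using that by simp
  qed
  \<comment> \<open>The left endpoint lies one unit beyond the bound because \<open>-R\<close>
    itself may belong to \<open>A\<close>; the absolute value keeps the interval nonempty for
    negative \<open>R\<close>.\<close>
  have "continuous_on {-\<bar>R\<bar>-1..\<bar>R\<bar>} \<alpha>"
  proof (rule lipschitz_on_continuous_on[of 1], rule lipschitz_onI)
    fix x y :: real
    show "dist (\<alpha> x) (\<alpha> y) \<le> 1 * dist x y"
      using lip[of x y] lip[of y x] by (cases "x \<le> y") (auto simp: dist_real_def)
  qed simp
  moreover have "\<alpha> (-\<bar>R\<bar>-1) = 0"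
  proof -
    have "A \<inter> {..-\<bar>R\<bar>-1} = {}" using A by auto
    then show ?thesis by (simp add: \<alpha>_def)
  qed
  moreover have "\<alpha> \<bar>R\<bar> = measure lborel A"
  proof -
    have "A \<inter> {..\<bar>R\<bar>} = A" using A by auto
    then show ?thesis by (simp add: \<alpha>_def)
  qed
  moreover have "-\<bar>R\<bar>-1 \<le> \<bar>R\<bar>" by arith
  ultimately obtain a where "\<alpha> a = t"
    using IVT'[of \<alpha> "-\<bar>R\<bar>-1" t "\<bar>R\<bar>"] t by metis
  then show ?thesis by (auto simp: \<alpha>_def)
qed

lemma emeasure_tri_le_times:
  fixes A B C :: "'a::euclidean_space set"
  assumes [measurable]: "A \<in> sets borel" "B \<in> sets borel" "C \<in> sets borel"
  shows "emeasure lborel (tri A B C) \<le> emeasure lborel A * emeasure lborel B"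
proof -
  have "emeasure lborel (tri A B C) \<le> emeasure lborel (A \<times> B)"
    by (intro emeasure_mono) (auto simp: tri_def borel_prod[symmetric])
  then show ?thesis by (simp add: emeasure_times)
qed

lemma emeasure_tri_real_le:
  fixes A B C :: "real set"
  assumes [measurable]: "A \<in> sets borel" "B \<in> sets borel" "C \<in> sets borel"
    and bounded: "A \<subseteq> {-R..R}" "B \<subseteq> {-R..R}" and C: "emeasure lborel C < \<infinity>"
    and t: "0 \<le> t" "t \<le> measure lborel A" "t \<le> measure lborel B"
  shows "emeasure lborel (tri A B C)
    \<le> ennreal (t * measure lborel C + (measure lborel A - t) * (measure lborel B - t))"
proof -
  obtain a where a: "measure lborel (A \<inter> {..a}) = t"
    using measure_atMost_quantile[OF assms(1) bounded(1)] t by auto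
  obtain b where b: "measure lborel (B \<inter> {..b}) = measure lborel B - t"
    using measure_atMost_quantile[OF assms(2) bounded(2), of "measure lborel B - t"] t by auto
  define A' where "A' = A \<inter> {a<..}"
  define B' where "B' = B \<inter> {..b}"
  have [measurable]: "A' \<in> sets borel" "B' \<in> sets borel" by (auto simp: A'_def B'_def)
  have fm: "S \<in> fmeasurable lborel" if "S \<in> sets borel" "S \<subseteq> A \<or> S \<subseteq> B" for S
    using that bounded by (intro fmeasurableI2[of "{-R..R}" lborel S]) (auto simp: fmeasurable_def emeasure_lborel_Icc_eq)
  have em: "emeasure lborel S = ennreal (measure lborel S)" if "S \<in> sets borel" "S \<subseteq> A \<or> S \<subseteq> B" for S
    using fm[OF that] by (simp add: emeasure_eq_measure2)
  have split: "measure lborel S = measure lborel (S \<inter> {..c}) + measure lborel (S \<inter> {c<..})"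
    if [measurable]: "S \<in> sets borel" and "S = A \<or> S = B" for S c
  proof -
    have "S = (S \<inter> {..c}) \<union> (S \<inter> {c<..})" by auto
    moreover have "measure lborel ((S \<inter> {..c}) \<union> (S \<inter> {c<..}))
        = measure lborel (S \<inter> {..c}) + measure lborel (S \<inter> {c<..})"
    proof (rule measure_Un_AE)
      show "AE x in lborel. x \<notin> S \<inter> {..c} \<or> x \<notin> S \<inter> {c<..}" by auto
    qed (use that in \<open>auto intro!: fm\<close>)
    ultimately show ?thesis by simp
  qed
  have mA': "measure lborel A' = measure lborel A - t" using split[of A a] a by (simp add: A'_def)
  have mB': "measure lborel B' = measure lborel B - t" using b by (simp add: B'_def)
  have mB'': "measure lborel (B \<inter> {b<..}) = t" using split[of B b] b by simp
  have key: "emeasure lborel {s \<in> A. x - s \<in> B} \<le> ennreal t + emeasure lborel {s \<in> A'. x - s \<in> B'}" for x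
  proof -
    have sets: "{s \<in> S. x - s \<in> S'} \<in> sets borel" if [measurable]: "S \<in> sets borel" "S' \<in> sets borel" for S S'
    proof -
      have "{s \<in> space borel. s \<in> S \<and> x - s \<in> S'} \<in> sets borel" by measurable
      then show ?thesis by simp
    qed
    \<comment> \<open>The condition \<open>b < x - s\<close> says \<open>s < x - b\<close>, so both
      conditions to be discarded describe left half-lines in \<open>s\<close>, and one contains the
      other. Hence a single set of measure \<open>t\<close> covers both, rather than two sets of
      total measure \<open>2 t\<close>.\<close>
    define E where "E = (if x - b \<le> a then A \<inter> {..a} else {s. x - s \<in> B \<inter> {b<..}})"
    have [measurable]: "E \<in> sets borel"
      using sets[of UNIV "B \<inter> {b<..}"] by (auto simp: E_def)
    have "emeasure lborel E = ennreal t"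
      using a mB'' by (auto simp: E_def em emeasure_vimage_reflect[of "B \<inter> {b<..}" x, simplified])
    moreover have "emeasure lborel {s \<in> A. x - s \<in> B} \<le> emeasure lborel (E \<union> {s \<in> A'. x - s \<in> B'})"
      by (rule emeasure_mono) (auto simp: E_def A'_def B'_def intro!: sets)
    moreover have "\<dots> \<le> emeasure lborel E + emeasure lborel {s \<in> A'. x - s \<in> B'}"
      by (rule emeasure_subadditive) (auto intro!: sets)
    ultimately show ?thesis by simp
  qed
  have [measurable]: "(\<lambda>x. emeasure lborel {s \<in> A'. x - s \<in> B'}) \<in> borel_measurable borel"
  proof -
    have "(\<lambda>x. \<integral>\<^sup>+s. indicator A' s * indicator B' (x - s) \<partial>lborel) \<in> borel_measurable borel"
      by measurable
    also have "(\<lambda>x. \<integral>\<^sup>+s. indicator A' s * indicator B' (x - s) \<partial>lborel)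
      = (\<lambda>x. emeasure lborel {s \<in> A'. x - s \<in> B'})"
    proof
      fix x
      have "{s \<in> space borel. s \<in> A' \<and> x - s \<in> B'} \<in> sets borel" by measurable
      then have [measurable]: "{s \<in> A'. x - s \<in> B'} \<in> sets borel" by simp
      have "emeasure lborel {s \<in> A'. x - s \<in> B'} = (\<integral>\<^sup>+s. indicator {s \<in> A'. x - s \<in> B'} s \<partial>lborel)"
        by simp
      also have "\<dots> = (\<integral>\<^sup>+s. indicator A' s * indicator B' (x - s) \<partial>lborel)"
        by (intro nn_integral_cong) (auto simp: indicator_def)
      finally show "(\<integral>\<^sup>+s. indicator A' s * indicator B' (x - s) \<partial>lborel)
        = emeasure lborel {s \<in> A'. x - s \<in> B'}" by simp
    qed
    finally show ?thesis .
  qed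
  have "emeasure lborel (tri A B C) = (\<integral>\<^sup>+x. indicator C x * emeasure lborel {s \<in> A. x - s \<in> B} \<partial>lborel)"
    by (rule emeasure_tri_conv) auto
  also have "\<dots> \<le> (\<integral>\<^sup>+x. ennreal t * indicator C x + indicator C x * emeasure lborel {s \<in> A'. x - s \<in> B'} \<partial>lborel)"
    using key by (intro nn_integral_mono) (auto simp: indicator_def)
  also have "\<dots> = ennreal t * emeasure lborel C + emeasure lborel (tri A' B' C)"
    by (subst nn_integral_add) (auto simp: emeasure_tri_conv nn_integral_cmult_indicator)
  \<comment> \<open>The condition on the sum is given up on \<open>A' \<times> B'\<close>. For
    centred intervals of lengths \<open>m\<close>, \<open>n\<close>, \<open>p\<close> and
    \<open>t = (m + n - p) / 2\<close> in the admissible range this loses nothing: the sums from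
    \<open>A'\<close> and \<open>B'\<close> then fill exactly the interval between
    \<open>-p/2\<close> and \<open>p/2\<close>.\<close>
  also have "\<dots> \<le> ennreal t * emeasure lborel C + emeasure lborel A' * emeasure lborel B'"
    by (intro add_left_mono emeasure_tri_le_times) auto
  also have "\<dots> = ennreal (t * measure lborel C + (measure lborel A - t) * (measure lborel B - t))"
  proof -
    have "emeasure lborel C = ennreal (measure lborel C)"
      using C by (simp add: emeasure_eq_ennreal_measure)
    moreover have "emeasure lborel A' = ennreal (measure lborel A - t)"
        "emeasure lborel B' = ennreal (measure lborel B - t)"
      using em[of A'] em[of B'] mA' mB' by (auto simp: A'_def B'_def)
    ultimately show ?thesis
      using t by (simp add: ennreal_plus ennreal_mult)
  qed
  finally show ?thesis .
qed

lemma emeasure_triangle: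
  fixes a b t :: real
  assumes t: "0 \<le> t"
  shows "emeasure lborel {p :: real \<times> real. fst p < a \<and> snd p < b \<and> a + b - t \<le> fst p + snd p} = ennreal (t\<^sup>2 / 2)"
proof -
  let ?T = "{p :: real \<times> real. fst p < a \<and> snd p < b \<and> a + b - t \<le> fst p + snd p}"
  have "{p \<in> space (borel :: (real \<times> real) measure). fst p < a \<and> snd p < b \<and> a + b - t \<le> fst p + snd p} \<in> sets borel"
    unfolding borel_prod[symmetric] by measurable
  then have [measurable]: "?T \<in> sets borel" by simp
  have "emeasure lborel ?T = (\<integral>\<^sup>+p. indicator ?T p \<partial>lborel)" by simp
  also have "\<dots> = (\<integral>\<^sup>+s. \<integral>\<^sup>+u. indicator ?T (s, u) \<partial>lborel \<partial>lborel)"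
    by (rule nn_integral_lborel_pair) simp
  also have "\<dots> = (\<integral>\<^sup>+s. ennreal (s - (a - t)) * indicator {a - t..a} s \<partial>lborel)"
  proof (rule nn_integral_cong_AE)
    \<comment> \<open>At \<open>s = a\<close> the slice is empty, whereas the closed interval
      required by the fundamental theorem gives the value \<open>t\<close>; hence equality almost
      everywhere.\<close>
    have eq: "(\<integral>\<^sup>+u. indicator ?T (s, u) \<partial>lborel) = ennreal (s - (a - t)) * indicator {a - t..a} s" if "s \<noteq> a" for s
    proof -
      have "(\<integral>\<^sup>+u. indicator ?T (s, u) \<partial>lborel)
          = (\<integral>\<^sup>+u. indicator (if s < a \<and> a - t \<le> s then {a + b - t - s..<b} else {}) u \<partial>lborel)"
        by (intro nn_integral_cong) (auto simp: indicator_def)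
      also have "\<dots> = emeasure lborel (if s < a \<and> a - t \<le> s then {a + b - t - s..<b} else {})"
        by (rule nn_integral_indicator) auto
      also have "\<dots> = ennreal (s - (a - t)) * indicator {a - t..a} s"
        using that by (auto simp: algebra_simps)
      finally show ?thesis .
    qed
    show "AE s in lborel. (\<integral>\<^sup>+u. indicator ?T (s, u) \<partial>lborel) = ennreal (s - (a - t)) * indicator {a - t..a} s"
      by (rule eventually_mono[OF AE_lborel_singleton[of a] eq])
  qed
  also have "\<dots> = ennreal ((a - (a - t))\<^sup>2 / 2 - ((a - t) - (a - t))\<^sup>2 / 2)"
    by (rule nn_integral_FTC_Icc[where F = "\<lambda>s. (s - (a - t))\<^sup>2 / 2"])
       (auto intro!: derivative_eq_intros simp: t)
  finally show ?thesis by simp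
qed

text \<open>The constraint on the sum cuts two opposite corners off the rectangle, right triangles
  with legs \<open>t\<close> and area \<open>t^2 / 2\<close> each, exchanged by the reflection in
  the origin. The additive form avoids subtraction in \<open>ennreal\<close>.\<close>

lemma emeasure_tri_intervals_ge:
  fixes m n p t :: real
  assumes nonneg: "0 \<le> m" "0 \<le> n" and t: "0 \<le> t" "t = (m + n - p) / 2"
  shows "ennreal (m * n) \<le> emeasure lborel (tri {-m/2<..<m/2} {-n/2<..<n/2} {-p/2<..<p/2}) + ennreal (t\<^sup>2)"
proof -
  let ?I = "tri {-m/2<..<m/2} {-n/2<..<n/2} {-p/2<..<p/2}"
  define T where "T = {p :: real \<times> real. fst p < m/2 \<and> snd p < n/2 \<and> m/2 + n/2 - t \<le> fst p + snd p}"
  have T: "emeasure lborel T = ennreal (t\<^sup>2 / 2)" unfolding T_def by (rule emeasure_triangle[OF t(1)])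
  have "{p \<in> space (borel :: (real \<times> real) measure). fst p < m/2 \<and> snd p < n/2 \<and> m/2 + n/2 - t \<le> fst p + snd p} \<in> sets borel"
    unfolding borel_prod[symmetric] by measurable
  then have [measurable]: "T \<in> sets borel" by (simp add: T_def)
  have T': "emeasure lborel {p. 0 - p \<in> T} = ennreal (t\<^sup>2 / 2)"
    by (subst emeasure_vimage_reflect) (auto simp: T)
  have [measurable]: "{p. 0 - p \<in> T} \<in> sets borel"
    using measurable_sets[of "\<lambda>p. 0 - p" borel borel T] by (auto simp: vimage_def)
  have [measurable]: "?I \<in> sets borel" by measurable
  have "ennreal (m * n) = emeasure lborel ({-m/2<..<m/2} \<times> {-n/2<..<n/2})"
    using nonneg by (simp add: emeasure_times ennreal_mult)
  also have "\<dots> \<le> emeasure lborel (?I \<union> (T \<union> {p. 0 - p \<in> T}))"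
  proof (rule emeasure_mono)
    show "{-m/2<..<m/2} \<times> {-n/2<..<n/2} \<subseteq> ?I \<union> (T \<union> {p. 0 - p \<in> T})"
      using t(2) by (auto simp: tri_def T_def)
  qed auto
  also have "\<dots> \<le> emeasure lborel ?I + emeasure lborel (T \<union> {p. 0 - p \<in> T})"
    by (rule emeasure_subadditive) auto
  also have "\<dots> \<le> emeasure lborel ?I + (emeasure lborel T + emeasure lborel {p. 0 - p \<in> T})"
    by (intro add_left_mono emeasure_subadditive) auto
  also have "emeasure lborel T + emeasure lborel {p. 0 - p \<in> T} = ennreal (t\<^sup>2)"
    unfolding T T' by (simp add: ennreal_plus[symmetric] del: ennreal_plus)
  finally show ?thesis .
qed

text \<open>The bound \<open>t * p + (m - t) * (n - t)\<close> is a quadratic in \<open>t\<close>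
  with minimum at \<open>(m + n - p) / 2\<close>. The four cases are this minimum clipped to the
  interval from 0 to \<open>min m n\<close>: \<open>t = 0\<close> when the constraint on the sum is
  void, \<open>t = m\<close> or \<open>t = n\<close> when every admissible sum lets the shorter
  interval fit inside the shifted longer one, and the interior minimum, with value
  \<open>m * n - t^2\<close>, when corners are cut off.\<close>

theorem riesz_real_bounded:
  fixes A B C :: "real set"
  assumes [measurable]: "A \<in> sets borel" "B \<in> sets borel" "C \<in> sets borel"
    and bounded: "A \<subseteq> {-R..R}" "B \<subseteq> {-R..R}" and C: "emeasure lborel C < \<infinity>"
    and m: "m = measure lborel A" and n: "n = measure lborel B" and p: "p = measure lborel C"
  shows "emeasure lborel (tri A B C) \<le> emeasure lborel (tri {-m/2<..<m/2} {-n/2<..<n/2} {-p/2<..<p/2})"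
    (is "_ \<le> emeasure lborel ?I")
proof -
  have nonneg: "0 \<le> m" "0 \<le> n" "0 \<le> p" by (auto simp: m n p)
  note le = emeasure_tri_real_le[OF assms(1-3) bounded C, folded m n p]
  consider "m + n \<le> p" | "p \<le> n - m" | "p \<le> m - n" | "p < m + n" "n - m < p" "m - n < p" by linarith
  then show ?thesis
  proof cases
    case 1
    then have "?I = {-m/2<..<m/2} \<times> {-n/2<..<n/2}" by (auto simp: tri_def)
    then have "emeasure lborel ?I = ennreal (m * n)"
      using nonneg by (simp add: emeasure_times ennreal_mult)
    then show ?thesis using le[of 0] nonneg by simp
  next
    case 2
    have "emeasure lborel ?I = (\<integral>\<^sup>+x. indicator {-p/2<..<p/2} x * emeasure lborel {s \<in> {-m/2<..<m/2}. x - s \<in> {-n/2<..<n/2}} \<partial>lborel)"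
      by (rule emeasure_tri_conv) auto
    also have "\<dots> = (\<integral>\<^sup>+x. ennreal m * indicator {-p/2<..<p/2} x \<partial>lborel)"
    proof (rule nn_integral_cong)
      fix x :: real
      have "{s \<in> {-m/2<..<m/2}. x - s \<in> {-n/2<..<n/2}} = {-m/2<..<m/2}" if "x \<in> {-p/2<..<p/2}"
        using that 2 by auto
      then show "indicator {-p/2<..<p/2} x * emeasure lborel {s \<in> {-m/2<..<m/2}. x - s \<in> {-n/2<..<n/2}}
         = ennreal m * indicator {-p/2<..<p/2} x"
        using nonneg by (cases "x \<in> {-p/2<..<p/2}") simp_all
    qed
    also have "\<dots> = ennreal (m * p)"
      using nonneg by (subst nn_integral_cmult_indicator) (auto simp: ennreal_mult)
    finally show ?thesis using le[of m] nonneg 2 by simp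
  next
    case 3
    have "emeasure lborel ?I = (\<integral>\<^sup>+x. indicator {-p/2<..<p/2} x * emeasure lborel {s \<in> {-m/2<..<m/2}. x - s \<in> {-n/2<..<n/2}} \<partial>lborel)"
      by (rule emeasure_tri_conv) auto
    also have "\<dots> = (\<integral>\<^sup>+x. ennreal n * indicator {-p/2<..<p/2} x \<partial>lborel)"
    proof (rule nn_integral_cong)
      fix x :: real
      have "{s \<in> {-m/2<..<m/2}. x - s \<in> {-n/2<..<n/2}} = {x-n/2<..<x+n/2}" if "x \<in> {-p/2<..<p/2}"
        using that 3 by auto
      then show "indicator {-p/2<..<p/2} x * emeasure lborel {s \<in> {-m/2<..<m/2}. x - s \<in> {-n/2<..<n/2}}
         = ennreal n * indicator {-p/2<..<p/2} x"
        using nonneg by (cases "x \<in> {-p/2<..<p/2}") simp_all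
    qed
    also have "\<dots> = ennreal (n * p)"
      using nonneg by (subst nn_integral_cmult_indicator) (auto simp: ennreal_mult)
    finally show ?thesis using le[of n] nonneg 3 by simp
  next
    case 4
    define t where "t = (m + n - p) / 2"
    have t: "0 \<le> t" "t \<le> m" "t \<le> n" using 4 by (auto simp: t_def)
    have eq: "t * p + (m - t) * (n - t) = m * n - t\<^sup>2"
      by (simp add: t_def power2_eq_square field_simps)
    have "t * t \<le> m * n" using t by (intro mult_mono) auto
    then have pos: "0 \<le> m * n - t\<^sup>2" by (simp add: power2_eq_square)
    have "ennreal (m * n - t\<^sup>2) + ennreal (t\<^sup>2) = ennreal (m * n)"
      using pos by (subst ennreal_plus[symmetric]) auto
    also have "\<dots> \<le> emeasure lborel ?I + ennreal (t\<^sup>2)"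
      by (rule emeasure_tri_intervals_ge) (use nonneg t in \<open>auto simp: t_def\<close>)
    finally have "ennreal (m * n - t\<^sup>2) \<le> emeasure lborel ?I" by simp
    then show ?thesis using le[OF t] eq by simp
  qed
qed

subsection \<open>Steiner symmetrization\<close>

text \<open>Coordinates along \<open>v\<close> are measured in units of the length of
  \<open>v\<close>. The vector is not normalized because translation by \<open>v\<close> must become
  the parameter shift by 1 when the gain of overlap is estimated.\<close>

definition axis_coord :: "'a::euclidean_space \<Rightarrow> 'a \<Rightarrow> real" where
  "axis_coord v x = (x \<bullet> v) / (v \<bullet> v)"

definition chord :: "'a::euclidean_space \<Rightarrow> 'a set \<Rightarrow> 'a \<Rightarrow> real set" where
  "chord v A x = {r. x + r *\<^sub>R v \<in> A}"

text \<open>On each line the chord becomes a segment centred at the hyperplane orthogonal to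
  \<open>v\<close>. The strict inequality makes it an open interval, so open centred balls are fixed
  exactly and not merely up to null sets.\<close>

definition steiner :: "'a::euclidean_space \<Rightarrow> 'a set \<Rightarrow> 'a set" where
  "steiner v A = {x. ennreal (2 * \<bar>axis_coord v x\<bar>) < emeasure lborel (chord v A x)}"

lemma axis_coord_add: "axis_coord v (x + y) = axis_coord v x + axis_coord v y"
  by (simp add: axis_coord_def inner_add_left add_divide_distrib)

lemma axis_coord_scaleR: "v \<noteq> 0 \<Longrightarrow> axis_coord v (r *\<^sub>R v) = r"
  by (simp add: axis_coord_def)

lemma axis_coord_measurable [measurable]: "axis_coord v \<in> borel_measurable borel"
  unfolding axis_coord_def[abs_def] by measurable

lemma chord_sets [measurable]:
  assumes [measurable]: "A \<in> sets borel"
  shows "chord v A x \<in> sets borel"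
proof -
  have "{r \<in> space borel. x + r *\<^sub>R v \<in> A} \<in> sets borel" by measurable
  then show ?thesis by (simp add: chord_def)
qed

lemma chord_mono: "A \<subseteq> B \<Longrightarrow> chord v A x \<subseteq> chord v B x"
  by (auto simp: chord_def)

lemma emeasure_chord:
  assumes [measurable]: "A \<in> sets borel"
  shows "emeasure lborel (chord v A x) = (\<integral>\<^sup>+r. indicator A (x + r *\<^sub>R v) \<partial>lborel)"
proof -
  have "emeasure lborel (chord v A x) = (\<integral>\<^sup>+r. indicator (chord v A x) r \<partial>lborel)" by simp
  also have "\<dots> = (\<integral>\<^sup>+r. indicator A (x + r *\<^sub>R v) \<partial>lborel)"
    by (intro nn_integral_cong) (auto simp: chord_def indicator_def)
  finally show ?thesis .
qed

lemma emeasure_chord_measurable [measurable]: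
  assumes [measurable]: "A \<in> sets borel"
  shows "(\<lambda>x. emeasure lborel (chord v A x)) \<in> borel_measurable borel"
  by (simp add: emeasure_chord)

lemma steiner_sets [measurable]:
  assumes [measurable]: "A \<in> sets borel"
  shows "steiner v A \<in> sets borel"
proof -
  have "{x \<in> space borel. ennreal (2 * \<bar>axis_coord v x\<bar>) < emeasure lborel (chord v A x)} \<in> sets borel"
    by measurable
  then show ?thesis by (simp add: steiner_def)
qed

text \<open>Every line in direction \<open>v\<close> meets the slab \<open>0 \<le> axis_coord v x < 1\<close> in a segment of
  parameter length 1, so Fubini along \<open>v\<close> needs only translation invariance.\<close>

lemma nn_integral_along_direction:
  fixes v :: "'a::euclidean_space"
  assumes [measurable]: "f \<in> borel_measurable borel" and v: "v \<noteq> 0"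
  shows "(\<integral>\<^sup>+x. f x \<partial>lborel) =
    (\<integral>\<^sup>+x. indicator {0..<1} (axis_coord v x) * (\<integral>\<^sup>+r. f (x + r *\<^sub>R v) \<partial>lborel) \<partial>lborel)"
proof -
  let ?W = "\<lambda>x. indicator {0..<1} (axis_coord v x) :: ennreal"
  have "(\<integral>\<^sup>+x. ?W x * (\<integral>\<^sup>+r. f (x + r *\<^sub>R v) \<partial>lborel) \<partial>lborel)
    = (\<integral>\<^sup>+x. \<integral>\<^sup>+r. ?W x * f (x + r *\<^sub>R v) \<partial>lborel \<partial>lborel)"
    by (intro nn_integral_cong nn_integral_cmult[symmetric]) measurable
  also have "\<dots> = (\<integral>\<^sup>+r. \<integral>\<^sup>+x. ?W x * f (x + r *\<^sub>R v) \<partial>lborel \<partial>lborel)"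
    by (rule nn_integral_lborel_swap) measurable
  also have "\<dots> = (\<integral>\<^sup>+r. \<integral>\<^sup>+x. ?W (- (r *\<^sub>R v) + x) * f x \<partial>lborel \<partial>lborel)"
  proof (rule nn_integral_cong)
    fix r :: real
    show "(\<integral>\<^sup>+x. ?W x * f (x + r *\<^sub>R v) \<partial>lborel) = (\<integral>\<^sup>+x. ?W (- (r *\<^sub>R v) + x) * f x \<partial>lborel)"
      using nn_integral_lborel_translate[of "\<lambda>x. ?W x * f (x + r *\<^sub>R v)" "- (r *\<^sub>R v)"] by simp
  qed
  also have "\<dots> = (\<integral>\<^sup>+x. \<integral>\<^sup>+r. ?W (- (r *\<^sub>R v) + x) * f x \<partial>lborel \<partial>lborel)"
    by (rule nn_integral_lborel_swap[symmetric]) measurable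
  also have "\<dots> = (\<integral>\<^sup>+x. f x \<partial>lborel)"
  proof (rule nn_integral_cong)
    fix x
    \<comment> \<open>Moving by \<open>- r\<close> along \<open>v\<close> lowers the coordinate by
      \<open>r\<close>, so the parameters that land in the slab form a half-open interval of length
      1.\<close>
    have c: "axis_coord v (- (r *\<^sub>R v) + x) = axis_coord v x - r" for r
      using axis_coord_add[of v "- (r *\<^sub>R v)" x] axis_coord_scaleR[OF v, of "-r"] by simp
    have "(\<integral>\<^sup>+r. ?W (- (r *\<^sub>R v) + x) * f x \<partial>lborel)
        = (\<integral>\<^sup>+r. f x * indicator {axis_coord v x - 1<..axis_coord v x} r \<partial>lborel)"
      unfolding c by (intro nn_integral_cong) (auto simp: indicator_def)
    also have "\<dots> = f x" by (subst nn_integral_cmult_indicator) auto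
    finally show "(\<integral>\<^sup>+r. ?W (- (r *\<^sub>R v) + x) * f x \<partial>lborel) = f x" .
  qed
  finally show ?thesis by simp
qed

lemma emeasure_along_direction:
  fixes v :: "'a::euclidean_space"
  assumes [measurable]: "A \<in> sets borel" and v: "v \<noteq> 0"
  shows "emeasure lborel A =
    (\<integral>\<^sup>+x. indicator {0..<1} (axis_coord v x) * emeasure lborel (chord v A x) \<partial>lborel)"
proof -
  have "emeasure lborel A = (\<integral>\<^sup>+x. indicator A x \<partial>lborel)" by simp
  also have "\<dots> = (\<integral>\<^sup>+x. indicator {0..<1} (axis_coord v x) * emeasure lborel (chord v A x) \<partial>lborel)"
    by (subst nn_integral_along_direction[OF _ v]) (auto simp: emeasure_chord)
  finally show ?thesis .
qed

text \<open>Summing points on the lines through \<open>x\<close> and \<open>y\<close> gives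
  \<open>(x + y) + (r + q) v\<close>: the parameters add as well. Thus the pairs split into
  one-dimensional problems of the same kind, with the third chord based at
  \<open>x + y\<close>.\<close>

lemma emeasure_tri_along_direction:
  fixes v :: "'a::euclidean_space"
  assumes [measurable]: "A \<in> sets borel" "B \<in> sets borel" "C \<in> sets borel" and v: "v \<noteq> 0"
  shows "emeasure lborel (tri A B C) =
    (\<integral>\<^sup>+x. indicator {0..<1} (axis_coord v x) * (\<integral>\<^sup>+y. indicator {0..<1} (axis_coord v y) *
       emeasure lborel (tri (chord v A x) (chord v B y) (chord v C (x + y))) \<partial>lborel) \<partial>lborel)"
proof -
  let ?W = "\<lambda>x. indicator {0..<1} (axis_coord v x) :: ennreal"
  let ?k = "\<lambda>s t. indicator A s * indicator B t * indicator C (s + t) :: ennreal"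
  have "emeasure lborel (tri A B C) = (\<integral>\<^sup>+s. \<integral>\<^sup>+t. ?k s t \<partial>lborel \<partial>lborel)"
    by (rule emeasure_tri) auto
  also have "\<dots> = (\<integral>\<^sup>+x. ?W x * (\<integral>\<^sup>+r. \<integral>\<^sup>+t. ?k (x + r *\<^sub>R v) t \<partial>lborel \<partial>lborel) \<partial>lborel)"
    by (rule nn_integral_along_direction[OF _ v]) measurable
  also have "\<dots> = (\<integral>\<^sup>+x. ?W x * (\<integral>\<^sup>+y. ?W y *
       emeasure lborel (tri (chord v A x) (chord v B y) (chord v C (x + y))) \<partial>lborel) \<partial>lborel)"
  proof (intro nn_integral_cong arg_cong2[where f = "(*)"] refl)
    fix x
    have "(\<integral>\<^sup>+r. \<integral>\<^sup>+t. ?k (x + r *\<^sub>R v) t \<partial>lborel \<partial>lborel)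
      = (\<integral>\<^sup>+r. \<integral>\<^sup>+y. ?W y * (\<integral>\<^sup>+q. ?k (x + r *\<^sub>R v) (y + q *\<^sub>R v) \<partial>lborel) \<partial>lborel \<partial>lborel)"
      by (rule nn_integral_cong, rule nn_integral_along_direction[OF _ v]) measurable
    also have "\<dots> = (\<integral>\<^sup>+y. \<integral>\<^sup>+r. ?W y * (\<integral>\<^sup>+q. ?k (x + r *\<^sub>R v) (y + q *\<^sub>R v) \<partial>lborel) \<partial>lborel \<partial>lborel)"
      by (rule nn_integral_lborel_swap) measurable
    also have "\<dots> = (\<integral>\<^sup>+y. ?W y *
       emeasure lborel (tri (chord v A x) (chord v B y) (chord v C (x + y))) \<partial>lborel)"
    proof (rule nn_integral_cong)
      fix y
      have "(\<integral>\<^sup>+r. ?W y * (\<integral>\<^sup>+q. ?k (x + r *\<^sub>R v) (y + q *\<^sub>R v) \<partial>lborel) \<partial>lborel)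
        = ?W y * (\<integral>\<^sup>+r. \<integral>\<^sup>+q. ?k (x + r *\<^sub>R v) (y + q *\<^sub>R v) \<partial>lborel \<partial>lborel)"
        by (rule nn_integral_cmult) measurable
      also have "(\<integral>\<^sup>+r. \<integral>\<^sup>+q. ?k (x + r *\<^sub>R v) (y + q *\<^sub>R v) \<partial>lborel \<partial>lborel)
        = (\<integral>\<^sup>+r. \<integral>\<^sup>+q. indicator (chord v A x) r * indicator (chord v B y) q
             * indicator (chord v C (x + y)) (r + q) \<partial>lborel \<partial>lborel)"
        by (intro nn_integral_cong) (auto simp: chord_def indicator_def algebra_simps)
      also have "\<dots> = emeasure lborel (tri (chord v A x) (chord v B y) (chord v C (x + y)))"
        by (rule emeasure_tri[symmetric]) auto
      finally show "(\<integral>\<^sup>+r. ?W y * (\<integral>\<^sup>+q. ?k (x + r *\<^sub>R v) (y + q *\<^sub>R v) \<partial>lborel) \<partial>lborel)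
        = ?W y * emeasure lborel (tri (chord v A x) (chord v B y) (chord v C (x + y)))" .
    qed
    finally show "(\<integral>\<^sup>+r. \<integral>\<^sup>+t. ?k (x + r *\<^sub>R v) t \<partial>lborel \<partial>lborel) = \<dots>" .
  qed
  finally show ?thesis .
qed

lemma chord_bounded:
  fixes v :: "'a::euclidean_space"
  assumes A: "A \<subseteq> ball 0 R" and v: "v \<noteq> 0" and K: "(R + norm x) / norm v \<le> K"
  shows "chord v A x \<subseteq> {-K..K}"
proof
  fix r assume "r \<in> chord v A x"
  then have "norm (x + r *\<^sub>R v) < R" using A by (auto simp: chord_def)
  moreover have "norm (r *\<^sub>R v) \<le> norm (x + r *\<^sub>R v) + norm x"
    using norm_triangle_ineq4[of "x + r *\<^sub>R v" x] by simp
  ultimately have "\<bar>r\<bar> * norm v \<le> R + norm x" by simp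
  then have "\<bar>r\<bar> \<le> (R + norm x) / norm v" using v by (simp add: field_simps)
  then show "r \<in> {-K..K}" using K by auto
qed

lemma emeasure_chord_finite:
  fixes v :: "'a::euclidean_space"
  assumes [measurable]: "A \<in> sets borel" and "A \<subseteq> ball 0 R" "v \<noteq> 0"
  shows "emeasure lborel (chord v A x) < \<infinity>"
proof -
  have "emeasure lborel (chord v A x) \<le> emeasure lborel {-((R + norm x) / norm v)..(R + norm x) / norm v}"
    using assms by (intro emeasure_mono chord_bounded) auto
  also have "\<dots> < \<infinity>" by (simp add: emeasure_lborel_Icc_eq)
  finally show ?thesis .
qed

text \<open>Moving the base point along the line only translates the chord, so the threshold in the
  definition of \<open>steiner\<close> is constant on each line. The centre of the new chord is the
  parameter at which the coordinate along \<open>v\<close> vanishes.\<close>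

lemma chord_steiner:
  fixes v :: "'a::euclidean_space"
  assumes "A \<in> sets borel" "A \<subseteq> ball 0 R" and v: "v \<noteq> 0"
  shows "chord v (steiner v A) x =
    {r. axis_coord v x + r \<in> {- measure lborel (chord v A x)/2<..<measure lborel (chord v A x)/2}}"
proof -
  have "chord v A (x + r *\<^sub>R v) = {q. r + q \<in> chord v A x}" for r
    by (auto simp: chord_def algebra_simps)
  then have "emeasure lborel (chord v A (x + r *\<^sub>R v)) = emeasure lborel (chord v A x)" for r
    using emeasure_vimage_translate[of "chord v A x" r] assms(1) by simp
  also have "\<dots> = ennreal (measure lborel (chord v A x))"
    using emeasure_chord_finite[OF assms, of x] by (simp add: emeasure_eq_ennreal_measure)
  finally have "x + r *\<^sub>R v \<in> steiner v A \<longleftrightarrow> 2 * \<bar>axis_coord v x + r\<bar> < measure lborel (chord v A x)" for r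
    using v by (simp add: steiner_def axis_coord_add axis_coord_scaleR ennreal_less_iff)
  moreover have "2 * \<bar>z\<bar> < m \<longleftrightarrow> z \<in> {- m/2<..<m/2}" for z m :: real
    by (simp add: abs_less_iff) linarith
  ultimately show ?thesis by (simp only: chord_def[of _ "steiner v A"])
qed

lemma emeasure_steiner:
  fixes v :: "'a::euclidean_space"
  assumes [measurable]: "A \<in> sets borel" and A: "A \<subseteq> ball 0 R" and v: "v \<noteq> 0"
  shows "emeasure lborel (steiner v A) = emeasure lborel A"
proof -
  have "emeasure lborel (chord v (steiner v A) x) = emeasure lborel (chord v A x)" for x
  proof -
    let ?m = "measure lborel (chord v A x)"
    have "emeasure lborel (chord v (steiner v A) x) = emeasure lborel {-?m/2<..<?m/2}"
      unfolding chord_steiner[OF assms] by (rule emeasure_vimage_translate) auto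
    also have "\<dots> = ennreal ?m" by simp
    also have "\<dots> = emeasure lborel (chord v A x)"
      using emeasure_chord_finite[OF assms, of x] by (simp add: emeasure_eq_ennreal_measure)
    finally show ?thesis .
  qed
  then show ?thesis by (simp add: emeasure_along_direction[OF _ v])
qed

lemma steiner_mono:
  assumes "A \<subseteq> B" "B \<in> sets borel"
  shows "steiner v A \<subseteq> steiner v B"
proof -
  have "emeasure lborel (chord v A x) \<le> emeasure lborel (chord v B x)" for x
    using assms by (intro emeasure_mono chord_mono) auto
  then show ?thesis by (auto simp: steiner_def intro: less_le_trans)
qed

text \<open>Completing the square turns membership of \<open>x + r v\<close> in the ball into
  \<open>(c + r)^2 < k\<close>. The chord is thus already an open interval centred at the parameter
  \<open>- c\<close>, and \<open>r = 0\<close> recovers the condition on \<open>x\<close>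
  itself.\<close>

lemma steiner_ball:
  fixes v :: "'a::euclidean_space"
  assumes v: "v \<noteq> 0" and \<rho>: "0 \<le> \<rho>"
  shows "steiner v (ball 0 \<rho>) = ball 0 \<rho>"
proof (rule set_eqI)
  fix x
  define c where "c = axis_coord v x"
  define k where "k = (\<rho>\<^sup>2 - (norm x)\<^sup>2) / (v \<bullet> v) + c\<^sup>2"
  have vv: "0 < v \<bullet> v" using v by simp
  have xv: "x \<bullet> v = c * (v \<bullet> v)" using v by (simp add: c_def axis_coord_def)
  have in_ball: "x + r *\<^sub>R v \<in> ball 0 \<rho> \<longleftrightarrow> (c + r)\<^sup>2 < k" for r
  proof -
    have "x + r *\<^sub>R v \<in> ball 0 \<rho> \<longleftrightarrow> (norm (x + r *\<^sub>R v))\<^sup>2 < \<rho>\<^sup>2"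
      using \<rho> power_mono_iff[of \<rho> "norm (x + r *\<^sub>R v)" 2] by (simp add: linorder_not_le[symmetric])
    also have "(norm (x + r *\<^sub>R v))\<^sup>2 = (norm x)\<^sup>2 + (2 * r * c + r\<^sup>2) * (v \<bullet> v)"
      unfolding power2_norm_eq_inner
      by (simp add: inner_add_left inner_add_right inner_commute[of v x] xv power2_eq_square algebra_simps)
    also have "\<dots> < \<rho>\<^sup>2 \<longleftrightarrow> (c + r)\<^sup>2 < k"
      using vv by (simp add: k_def power2_eq_square field_simps)
    finally show ?thesis .
  qed
  \<comment> \<open>Here \<open>sqrt\<close> is extended as an odd function, so for negative
    \<open>k\<close> both sides are false, the interval below is empty, and
    \<open>ennreal (2 * sqrt k)\<close> is 0. No case distinction on lines missing the ball is
    needed.\<close>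
  have abs_less: "y\<^sup>2 < k \<longleftrightarrow> \<bar>y\<bar> < sqrt k" for y :: real
    using real_sqrt_less_iff[of "y\<^sup>2" k] by simp
  have "chord v (ball 0 \<rho>) x = {-c - sqrt k<..<-c + sqrt k}"
    unfolding chord_def in_ball abs_less by (auto simp: abs_less_iff)
  moreover have "emeasure lborel {-c - sqrt k<..<-c + sqrt k} = ennreal (2 * sqrt k)"
    by (cases "0 \<le> sqrt k") (auto simp: ennreal_neg)
  ultimately have "x \<in> steiner v (ball 0 \<rho>) \<longleftrightarrow> ennreal (2 * \<bar>c\<bar>) < ennreal (2 * sqrt k)"
    by (simp add: steiner_def c_def)
  also have "\<dots> \<longleftrightarrow> \<bar>c\<bar> < sqrt k" by (simp add: ennreal_less_iff)
  also have "\<dots> \<longleftrightarrow> x \<in> ball 0 \<rho>" using in_ball[of 0] abs_less[of c] by simp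
  finally show "x \<in> steiner v (ball 0 \<rho>) \<longleftrightarrow> x \<in> ball 0 \<rho>" .
qed

lemma steiner_subset_ball:
  fixes v :: "'a::euclidean_space"
  assumes "A \<subseteq> ball 0 \<rho>" "v \<noteq> 0" "0 \<le> \<rho>"
  shows "steiner v A \<subseteq> ball 0 \<rho>"
  using steiner_mono[of A "ball 0 \<rho>" v] steiner_ball[of v \<rho>] assms by auto

lemma emeasure_tri_vimage_translate:
  fixes A B C :: "'a::euclidean_space set"
  assumes [measurable]: "A \<in> sets borel" "B \<in> sets borel" "C \<in> sets borel"
  shows "emeasure lborel (tri {r. a + r \<in> A} {r. b + r \<in> B} {r. a + b + r \<in> C}) = emeasure lborel (tri A B C)"
proof -
  have "tri {r. a + r \<in> A} {r. b + r \<in> B} {r. a + b + r \<in> C} = {p. (a, b) + p \<in> tri A B C}"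
    by (auto simp: tri_def algebra_simps)
  then show ?thesis by (simp add: emeasure_vimage_translate)
qed

text \<open>The symmetrized chords are centred intervals shifted by the coordinates of
  \<open>x\<close>, \<open>y\<close> and \<open>x + y\<close>. These coordinates add up, so the
  three shifts are compatible and cancel by translation invariance in the plane, leaving the
  one-dimensional inequality on each pair of lines.\<close>

lemma emeasure_tri_le_steiner:
  fixes v :: "'a::euclidean_space"
  assumes [measurable]: "A \<in> sets borel" "B \<in> sets borel" "C \<in> sets borel"
    and ball: "A \<subseteq> ball 0 R" "B \<subseteq> ball 0 R" "C \<subseteq> ball 0 R" and v: "v \<noteq> 0"
  shows "emeasure lborel (tri A B C) \<le> emeasure lborel (tri (steiner v A) (steiner v B) (steiner v C))"
proof -
  have "emeasure lborel (tri (chord v A x) (chord v B y) (chord v C (x + y)))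
    \<le> emeasure lborel (tri (chord v (steiner v A) x) (chord v (steiner v B) y) (chord v (steiner v C) (x + y)))"
    for x y
  proof -
    \<comment> \<open>The one-dimensional inequality takes a common bound for the first two chords,
      which lie on different lines.\<close>
    define K where "K = max ((R + norm x) / norm v) ((R + norm y) / norm v)"
    have "chord v A x \<subseteq> {-K..K}" "chord v B y \<subseteq> {-K..K}"
      by (rule chord_bounded[OF ball(1) v] chord_bounded[OF ball(2) v], simp only: K_def max.cobounded1 max.cobounded2)+
    then show ?thesis
      unfolding chord_steiner[OF assms(1) ball(1) v] chord_steiner[OF assms(2) ball(2) v]
        chord_steiner[OF assms(3) ball(3) v] axis_coord_add
      by (subst emeasure_tri_vimage_translate)
         (simp_all only: chord_sets[OF assms(1)] chord_sets[OF assms(2)] chord_sets[OF assms(3)] borel_open open_greaterThanLessThan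
           riesz_real_bounded[OF _ _ _ _ _ emeasure_chord_finite[OF assms(3) ball(3) v] refl refl refl])
  qed
  then show ?thesis
    unfolding emeasure_tri_along_direction[OF assms(1-3) v]
      emeasure_tri_along_direction[OF steiner_sets steiner_sets steiner_sets v, OF assms(1-3)]
    by (intro nn_integral_mono mult_left_mono) auto
qed

text \<open>The second summand consists of points of the ball missing from \<open>A\<close> whose
  translates by \<open>- v\<close> are surplus points of \<open>A\<close>. On a line in direction
  \<open>v\<close> it is no longer than the missing part nor than the surplus part, so together with
  the overlap it is at most the minimum of the two chord lengths.\<close>

lemma emeasure_steiner_inter_ball:
  fixes v :: "'a::euclidean_space"
  assumes A[measurable]: "A \<in> sets borel" and ball: "A \<subseteq> ball 0 R" and v: "v \<noteq> 0" and \<rho>: "0 \<le> \<rho>"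
    and D: "D = ball 0 \<rho>"
  shows "emeasure lborel (A \<inter> D) + emeasure lborel {x \<in> D - A. x - v \<in> A - D}
    \<le> emeasure lborel (steiner v A \<inter> D)"
proof -
  have [measurable]: "D \<in> sets borel" by (simp add: D)
  have sD: "steiner v D = D" by (simp add: D steiner_ball[OF v \<rho>])
  define N where "N = {x \<in> D - A. x - v \<in> A - D}"
  have "{x \<in> space borel. x \<in> D - A \<and> x - v \<in> A - D} \<in> sets borel" by measurable
  then have [measurable]: "N \<in> sets borel" by (simp add: N_def)
  have key: "emeasure lborel (chord v (A \<inter> D) x) + emeasure lborel (chord v N x)
    \<le> emeasure lborel (chord v (steiner v A \<inter> D) x)" for x
  proof -
    let ?a = "measure lborel (chord v A x)" and ?d = "measure lborel (chord v D x)"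
    have a: "emeasure lborel (chord v A x) = ennreal ?a"
      using emeasure_chord_finite[OF A ball v, of x] by (simp add: emeasure_eq_ennreal_measure)
    have d: "emeasure lborel (chord v D x) = ennreal ?d"
      using emeasure_chord_finite[of D \<rho> v x] v by (simp add: emeasure_eq_ennreal_measure D)
    have un: "emeasure lborel (chord v (A \<inter> D) x) + emeasure lborel (chord v E x) = emeasure lborel (chord v F x)"
      if [measurable]: "E \<in> sets borel" "F \<in> sets borel" and "F = (A \<inter> D) \<union> E" "E \<inter> (A \<inter> D) = {}" for E F
      using that by (subst plus_emeasure) (auto simp: chord_def intro: arg_cong2[where f = emeasure])
    have "emeasure lborel (chord v (A \<inter> D) x) + emeasure lborel (chord v N x)
      \<le> emeasure lborel (chord v (A \<inter> D) x) + emeasure lborel (chord v (D - A) x)"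
      by (intro add_left_mono emeasure_mono chord_mono) (auto simp: N_def)
    also have "\<dots> = ennreal ?d" unfolding d[symmetric] by (rule un) auto
    finally have 1: "emeasure lborel (chord v (A \<inter> D) x) + emeasure lborel (chord v N x) \<le> ennreal ?d" .
    \<comment> \<open>Subtracting \<open>v\<close> is the parameter shift by \<open>-1\<close>,
      which places the chord of \<open>N\<close> inside a translate of the chord of
      \<open>A - D\<close>.\<close>
    have "emeasure lborel (chord v (A \<inter> D) x) + emeasure lborel (chord v N x)
      \<le> emeasure lborel (chord v (A \<inter> D) x) + emeasure lborel {r. -1 + r \<in> chord v (A - D) x}"
    proof (intro add_left_mono emeasure_mono)
      show "chord v N x \<subseteq> {r. -1 + r \<in> chord v (A - D) x}"
        by (auto simp: chord_def N_def algebra_simps)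
      show "{r. -1 + r \<in> chord v (A - D) x} \<in> sets lborel"
        using measurable_sets[of "\<lambda>r. -1 + r" borel borel "chord v (A - D) x"] by (auto simp: vimage_def)
    qed
    also have "\<dots> = emeasure lborel (chord v (A \<inter> D) x) + emeasure lborel (chord v (A - D) x)"
      by (subst emeasure_vimage_translate) auto
    also have "\<dots> = ennreal ?a" unfolding a[symmetric] by (rule un) auto
    finally have 2: "emeasure lborel (chord v (A \<inter> D) x) + emeasure lborel (chord v N x) \<le> ennreal ?a" .
    \<comment> \<open>Both chords are intervals with the same centre, hence nested, and their
      intersection has the smaller of the two lengths.\<close>
    let ?m = "min ?a ?d"
    have "chord v (steiner v A \<inter> D) x = chord v (steiner v A) x \<inter> chord v (steiner v D) x"
      unfolding sD by (auto simp: chord_def)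
    also have "\<dots> = {r. axis_coord v x + r \<in> {-?m/2<..<?m/2}}"
      unfolding chord_steiner[OF A ball v] using v
      by (subst chord_steiner[of D \<rho> v]) (auto simp: D min_def)
    finally have "emeasure lborel (chord v (steiner v A \<inter> D) x) = emeasure lborel {-?m/2<..<?m/2}"
      by (simp only:) (rule emeasure_vimage_translate, simp)
    moreover have "emeasure lborel {-?m/2<..<?m/2} = ennreal ?m"
      using measure_nonneg[of lborel "chord v A x"] measure_nonneg[of lborel "chord v D x"]
      by (subst emeasure_lborel_Ioo) (auto simp: min_def simp del: measure_nonneg)
    ultimately have "emeasure lborel (chord v (steiner v A \<inter> D) x) = ennreal ?m" by simp
    then show ?thesis using 1 2 by (simp add: min_def)
  qed
  have "emeasure lborel (A \<inter> D) + emeasure lborel N =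
    (\<integral>\<^sup>+x. indicator {0..<1} (axis_coord v x) * (emeasure lborel (chord v (A \<inter> D) x)
       + emeasure lborel (chord v N x)) \<partial>lborel)"
    by (subst (1 2) emeasure_along_direction[OF _ v]) (auto simp: nn_integral_add distrib_left)
  also have "\<dots> \<le> (\<integral>\<^sup>+x. indicator {0..<1} (axis_coord v x) * emeasure lborel (chord v (steiner v A \<inter> D) x) \<partial>lborel)"
    by (intro nn_integral_mono mult_left_mono key) auto
  also have "\<dots> = emeasure lborel (steiner v A \<inter> D)"
    by (rule emeasure_along_direction[OF _ v, symmetric]) measurable
  finally show ?thesis by (simp add: N_def)
qed

subsection \<open>Riesz's inequality for sets\<close>

lemma fmeasurable_subset_ball:
  fixes A :: "'a::euclidean_space set"
  assumes "A \<in> sets borel" "A \<subseteq> ball 0 R"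
  shows "A \<in> fmeasurable lborel"
  using assms emeasure_lborel_ball_finite[of 0 R]
  by (intro fmeasurableI2[of "ball 0 R" lborel A]) (auto simp: fmeasurable_def)

lemma emeasure_subset_ball:
  fixes A :: "'a::euclidean_space set"
  assumes "A \<in> sets borel" "A \<subseteq> ball 0 R"
  shows "emeasure lborel A = ennreal (measure lborel A)"
  using fmeasurable_subset_ball[OF assms] by (simp add: emeasure_eq_measure2)

text \<open>By Fubini, the overlap of \<open>M\<close> with the translate of \<open>L\<close> by
  \<open>v\<close> has integral \<open>|M| |L|\<close> over \<open>v\<close>, and it vanishes
  outside the ball of radius \<open>2 R\<close>. The factor 2 is slack: if all overlaps were too
  small, the non-strict comparison of integrals would already be contradictory.\<close>

lemma exists_overlapping_translate:
  fixes M L :: "'a::euclidean_space set"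
  assumes [measurable]: "M \<in> sets borel" "L \<in> sets borel"
    and ball: "M \<subseteq> ball 0 R" "L \<subseteq> ball 0 R" and R: "0 < R"
    and pos: "0 < measure lborel M * measure lborel L"
  shows "\<exists>v. measure lborel M * measure lborel L
    \<le> 2 * measure lborel (ball (0::'a) (2 * R)) * measure lborel {x \<in> M. x - v \<in> L}"
proof (rule ccontr)
  assume contr: "\<not> ?thesis"
  let ?V = "measure lborel (ball (0::'a) (2 * R))"
  let ?P = "measure lborel M * measure lborel L"
  define N where "N v = {x \<in> M. x - v \<in> L}" for v
  have [measurable]: "N v \<in> sets borel" for v
  proof -
    have "{x \<in> space borel. x \<in> M \<and> x - v \<in> L} \<in> sets borel" by measurable
    then show ?thesis by (simp add: N_def)
  qed
  have N_em: "emeasure lborel (N v) = ennreal (measure lborel (N v))" for v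
    by (rule emeasure_subset_ball) (use ball in \<open>auto simp: N_def\<close>)
  have V: "0 < ?V" using R by simp
  have "2 * ennreal ?V * ennreal ?P = 2 * ennreal ?V * (emeasure lborel M * emeasure lborel L)"
    using emeasure_subset_ball[OF _ ball(1)] emeasure_subset_ball[OF _ ball(2)] by (simp add: ennreal_mult)
  also have "emeasure lborel M * emeasure lborel L = (\<integral>\<^sup>+x. indicator M x * emeasure lborel L \<partial>lborel)"
    by (simp add: nn_integral_multc)
  also have "\<dots> = (\<integral>\<^sup>+x. \<integral>\<^sup>+v. indicator M x * indicator L (x - v) \<partial>lborel \<partial>lborel)"
  proof (rule nn_integral_cong)
    fix x
    have "(\<integral>\<^sup>+v. indicator M x * indicator L (x - v) \<partial>lborel) = indicator M x * (\<integral>\<^sup>+v. indicator L (x - v) \<partial>lborel)"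
      by (rule nn_integral_cmult) measurable
    also have "(\<integral>\<^sup>+v. indicator L (x - v) \<partial>lborel) = emeasure lborel L"
      by (subst nn_integral_lborel_reflect) auto
    finally show "indicator M x * emeasure lborel L = (\<integral>\<^sup>+v. indicator M x * indicator L (x - v) \<partial>lborel)" by simp
  qed
  also have "\<dots> = (\<integral>\<^sup>+v. \<integral>\<^sup>+x. indicator M x * indicator L (x - v) \<partial>lborel \<partial>lborel)"
    by (rule nn_integral_lborel_swap) measurable
  also have "\<dots> = (\<integral>\<^sup>+v. emeasure lborel (N v) \<partial>lborel)"
  proof (rule nn_integral_cong)
    fix v
    have "(\<integral>\<^sup>+x. indicator M x * indicator L (x - v) \<partial>lborel) = (\<integral>\<^sup>+x. indicator (N v) x \<partial>lborel)"
      by (intro nn_integral_cong) (auto simp: N_def indicator_def)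
    then show "(\<integral>\<^sup>+x. indicator M x * indicator L (x - v) \<partial>lborel) = emeasure lborel (N v)" by simp
  qed
  also have "2 * ennreal ?V * (\<integral>\<^sup>+v. emeasure lborel (N v) \<partial>lborel) = (\<integral>\<^sup>+v. 2 * ennreal ?V * emeasure lborel (N v) \<partial>lborel)"
  proof (rule nn_integral_cmult[symmetric])
    have "(\<lambda>v. \<integral>\<^sup>+x. indicator M x * indicator L (x - v) \<partial>lborel) \<in> borel_measurable lborel" by measurable
    also have "(\<lambda>v. \<integral>\<^sup>+x. indicator M x * indicator L (x - v) \<partial>lborel) = (\<lambda>v. emeasure lborel (N v))"
    proof
      fix v
      have "(\<integral>\<^sup>+x. indicator M x * indicator L (x - v) \<partial>lborel) = (\<integral>\<^sup>+x. indicator (N v) x \<partial>lborel)"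
        by (intro nn_integral_cong) (auto simp: N_def indicator_def)
      then show "(\<integral>\<^sup>+x. indicator M x * indicator L (x - v) \<partial>lborel) = emeasure lborel (N v)" by simp
    qed
    finally show "(\<lambda>v. emeasure lborel (N v)) \<in> borel_measurable lborel" .
  qed
  also have "\<dots> \<le> (\<integral>\<^sup>+v. ennreal ?P * indicator (ball (0::'a) (2 * R)) v \<partial>lborel)"
  proof (rule nn_integral_mono)
    fix v :: 'a
    show "2 * ennreal ?V * emeasure lborel (N v) \<le> ennreal ?P * indicator (ball 0 (2 * R)) v"
    proof (cases "v \<in> ball 0 (2 * R)")
      case True
      have "2 * ?V * measure lborel (N v) \<le> ?P" using contr by (auto simp: N_def not_le intro: less_imp_le)
      then have "ennreal (2 * ?V * measure lborel (N v)) \<le> ennreal ?P" by (rule ennreal_leI)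
      then show ?thesis using True by (simp add: N_em ennreal_mult)
    next
      case False
      have "N v = {}"
      proof (rule equals0I)
        fix x assume "x \<in> N v"
        then have "norm x < R" "norm (x - v) < R" using ball by (auto simp: N_def)
        then have "norm v < 2 * R" using norm_triangle_ineq4[of x "x - v"] by simp
        then show False using False by simp
      qed
      then show ?thesis by simp
    qed
  qed
  also have "\<dots> = ennreal (?P * ?V)"
    using emeasure_subset_ball[of "ball (0::'a) (2 * R)" "2 * R"]
    by (subst nn_integral_cmult_indicator) (auto simp: ennreal_mult)
  finally have "ennreal (2 * ?V * ?P) \<le> ennreal (?P * ?V)" by (simp add: ennreal_mult)
  then have "2 * (?V * ?P) \<le> ?V * ?P" using pos V by (simp add: ennreal_le_iff mult.commute)
  then show False using mult_pos_pos[OF V pos] by linarith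
qed

lemma measure_steiner_inter_ball:
  fixes v :: "'a::euclidean_space"
  assumes [measurable]: "A \<in> sets borel" and ball: "A \<subseteq> ball 0 R" and v: "v \<noteq> 0" and \<rho>: "0 \<le> \<rho>"
    and D: "D = ball 0 \<rho>"
  shows "measure lborel (A \<inter> D) + measure lborel {x \<in> D - A. x - v \<in> A - D}
    \<le> measure lborel (steiner v A \<inter> D)"
proof -
  have [measurable]: "D \<in> sets borel" by (simp add: D)
  have "{x \<in> space borel. x \<in> D - A \<and> x - v \<in> A - D} \<in> sets borel" by measurable
  then have [measurable]: "{x \<in> D - A. x - v \<in> A - D} \<in> sets borel" by simp
  have "emeasure lborel S = ennreal (measure lborel S)" if "S \<in> sets borel" "S \<subseteq> D" for S
    using that by (intro emeasure_subset_ball[of S \<rho>]) (auto simp: D)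
  from this[of "A \<inter> D"] this[of "{x \<in> D - A. x - v \<in> A - D}"] this[of "steiner v A \<inter> D"]
  show ?thesis
    using emeasure_steiner_inter_ball[OF assms(1) ball v \<rho> D]
    by (auto simp flip: ennreal_plus)
qed

text \<open>Since \<open>A\<close> and the ball have equal measure, the missing part
  \<open>D - A\<close> and the surplus \<open>A - D\<close> have the same measure, at least
  \<open>d\<close>. A translation matching a definite share of them gives the direction. The gain
  depends only on \<open>d\<close> and \<open>R\<close>, not on \<open>A\<close>, which the supremum
  argument requires.\<close>

lemma exists_steiner_gain:
  fixes A D :: "'a::euclidean_space set"
  assumes A[measurable]: "A \<in> sets borel" and ball: "A \<subseteq> ball 0 R" and \<rho>: "0 \<le> \<rho>" "\<rho> \<le> R" and R: "0 < R"
    and D: "D = ball 0 \<rho>" and eq: "measure lborel A = measure lborel D"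
    and d: "0 < d" "d \<le> measure lborel D - measure lborel (A \<inter> D)"
  shows "\<exists>v. v \<noteq> 0 \<and> measure lborel (A \<inter> D) + d\<^sup>2 / (2 * measure lborel (ball (0::'a) (2 * R)))
    \<le> measure lborel (steiner v A \<inter> D)"
proof -
  have [measurable]: "D \<in> sets borel" by (simp add: D)
  let ?V = "measure lborel (ball (0::'a) (2 * R))"
  define \<delta> where "\<delta> = measure lborel D - measure lborel (A \<inter> D)"
  have V: "0 < ?V" using R by simp
  have DR: "D \<subseteq> ball 0 R" using \<rho> by (auto simp: D)
  have fm: "A \<in> fmeasurable lborel" "D \<in> fmeasurable lborel" "A \<inter> D \<in> fmeasurable lborel"
    using ball DR by (auto intro!: fmeasurable_subset_ball[of _ R])
  have "D - A = D - A \<inter> D" "A - D = A - A \<inter> D" by auto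
  then have diff: "measure lborel (D - A) = \<delta>" "measure lborel (A - D) = \<delta>"
    using fm eq by (auto simp: \<delta>_def measurable_measure_Diff fmeasurableD)
  have \<delta>: "0 < \<delta>" "d \<le> \<delta>" using d by (auto simp: \<delta>_def)
  obtain v where v: "\<delta> * \<delta> \<le> 2 * ?V * measure lborel {x \<in> D - A. x - v \<in> A - D}"
    using exists_overlapping_translate[of "D - A" "A - D" R] diff \<delta> R ball DR by auto
  \<comment> \<open>The zero vector defines no direction; it is excluded because
    \<open>D - A\<close> and \<open>A - D\<close> are disjoint, so without a translation nothing
    overlaps.\<close>
  have v0: "v \<noteq> 0"
  proof
    assume "v = 0"
    then have "{x \<in> D - A. x - v \<in> A - D} = {}" by auto
    then have "\<delta> * \<delta> \<le> 0" using v by (simp only: measure_empty mult_zero_right)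
    then show False using \<delta> mult_pos_pos[of \<delta> \<delta>] by linarith
  qed
  have "d\<^sup>2 \<le> \<delta> * \<delta>" using d \<delta> by (simp add: power2_eq_square mult_mono)
  then have "d\<^sup>2 / (2 * ?V) \<le> measure lborel {x \<in> D - A. x - v \<in> A - D}"
    using v V by (subst pos_divide_le_eq) (auto simp: mult.commute)
  then show ?thesis
    using measure_steiner_inter_ball[OF A ball v0 \<rho>(1) D] v0 by (intro exI[of _ v]) auto
qed

lemma emeasure_tri_UNIV:
  fixes A C :: "'a::euclidean_space set"
  assumes [measurable]: "A \<in> sets borel" "C \<in> sets borel"
  shows "emeasure lborel (tri A UNIV C) = emeasure lborel A * emeasure lborel C"
proof -
  have "emeasure lborel (tri A UNIV C) = (\<integral>\<^sup>+s. \<integral>\<^sup>+t. indicator A s * indicator C (s + t) \<partial>lborel \<partial>lborel)"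
    by (subst emeasure_tri) auto
  also have "\<dots> = (\<integral>\<^sup>+s. indicator A s * emeasure lborel C \<partial>lborel)"
  proof (rule nn_integral_cong)
    fix s
    have "(\<integral>\<^sup>+t. indicator A s * indicator C (s + t) \<partial>lborel) = indicator A s * (\<integral>\<^sup>+t. indicator C (s + t) \<partial>lborel)"
      by (rule nn_integral_cmult) measurable
    also have "(\<integral>\<^sup>+t. indicator C (s + t) \<partial>lborel) = emeasure lborel C"
      by (subst nn_integral_lborel_translate) auto
    finally show "(\<integral>\<^sup>+t. indicator A s * indicator C (s + t) \<partial>lborel) = indicator A s * emeasure lborel C" .
  qed
  also have "\<dots> = emeasure lborel A * emeasure lborel C" by (simp add: nn_integral_multc)
  finally show ?thesis .
qed

text \<open>A pair lost in passing to \<open>A'\<close>, \<open>B'\<close>, \<open>C'\<close> has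
  its first entry in \<open>A - A'\<close>, its second in \<open>B - B'\<close>, or its sum in
  \<open>C - C'\<close>. In the last case the second entry is controlled by the sum, which gives the
  product of the measures of \<open>A\<close> and \<open>C - C'\<close>.\<close>

lemma emeasure_tri_perturb:
  fixes A B C A' B' C' :: "'a::euclidean_space set"
  assumes [measurable]: "A \<in> sets borel" "B \<in> sets borel" "C \<in> sets borel"
    "A' \<in> sets borel" "B' \<in> sets borel" "C' \<in> sets borel"
  shows "emeasure lborel (tri A B C) \<le> emeasure lborel (tri A' B' C')
    + (emeasure lborel (A - A') * emeasure lborel B + (emeasure lborel A * emeasure lborel (B - B')
    + emeasure lborel A * emeasure lborel (C - C')))"
proof -
  have [measurable]: "S \<times> T \<in> sets borel" if "S \<in> sets borel" "T \<in> sets borel" for S T :: "'a set"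
    using that by (simp add: borel_prod[symmetric])
  let ?U = "tri A' B' C'" and ?V = "(A - A') \<times> B" and ?W = "A \<times> (B - B')" and ?X = "tri A UNIV (C - C')"
  have "emeasure lborel (tri A B C) \<le> emeasure lborel (?U \<union> (?V \<union> (?W \<union> ?X)))"
  proof (rule emeasure_mono)
    show "tri A B C \<subseteq> ?U \<union> (?V \<union> (?W \<union> ?X))" by (auto simp: tri_def)
    have "?U \<union> (?V \<union> (?W \<union> ?X)) \<in> sets borel" by measurable
    then show "?U \<union> (?V \<union> (?W \<union> ?X)) \<in> sets lborel" by simp
  qed
  also have "\<dots> \<le> emeasure lborel ?U + emeasure lborel (?V \<union> (?W \<union> ?X))"
    by (rule emeasure_subadditive) measurable
  also have "\<dots> \<le> emeasure lborel ?U + (emeasure lborel ?V + emeasure lborel (?W \<union> ?X))"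
    by (rule add_left_mono, rule emeasure_subadditive) measurable
  also have "\<dots> \<le> emeasure lborel ?U + (emeasure lborel ?V + (emeasure lborel ?W + emeasure lborel ?X))"
    by (rule add_left_mono, rule add_left_mono, rule emeasure_subadditive) measurable
  finally show ?thesis by (simp add: emeasure_times emeasure_tri_UNIV)
qed

text \<open>Averaging over \<open>v\<close> gives a direction in which Steiner symmetrization raises the overlap
  with the balls by an amount bounded below in terms of the defect; hence the supremum of the
  overlaps over all triples reachable by symmetrization is the total volume.\<close>

proposition riesz_bounded:
  fixes A B C :: "'a::euclidean_space set"
  assumes [measurable]: "A \<in> sets borel" "B \<in> sets borel" "C \<in> sets borel"
    and ball: "A \<subseteq> ball 0 R" "B \<subseteq> ball 0 R" "C \<subseteq> ball 0 R"
    and r: "0 \<le> a" "0 \<le> b" "0 \<le> c"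
    and a: "emeasure lborel (ball (0::'a) a) = emeasure lborel A"
    and b: "emeasure lborel (ball (0::'a) b) = emeasure lborel B"
    and c: "emeasure lborel (ball (0::'a) c) = emeasure lborel C"
  shows "emeasure lborel (tri A B C) \<le> emeasure lborel (tri (ball (0::'a) a) (ball 0 b) (ball 0 c))"
proof -
  \<comment> \<open>One radius for the three sets and the three balls fixes the gain constant for
    all triples; the entry 1 makes it positive.\<close>
  define K where "K = Max {R, a, b, c, 1}"
  have K: "R \<le> K" "a \<le> K" "b \<le> K" "c \<le> K" "0 < K" 
    by (simp_all add: K_def)
  let ?\<mu> = "measure lborel :: 'a set \<Rightarrow> real"
  let ?Da = "ball 0 a :: 'a set" and ?Db = "ball 0 b :: 'a set" and ?Dc = "ball 0 c :: 'a set"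
  define \<kappa> where "\<kappa> = 2 * ?\<mu> (ball 0 (2 * K))"
  have \<kappa>: "0 < \<kappa>" using K by (simp add: \<kappa>_def)
  \<comment> \<open>The predicate records invariants instead of a history of symmetrizations:
    containment, the three measures, and a triple measure no smaller than at the start. They are
    preserved by symmetrizing all three sets in a common direction.\<close>
  define P where "P X Y Z \<longleftrightarrow> X \<in> sets borel \<and> Y \<in> sets borel \<and> Z \<in> sets borel
    \<and> X \<subseteq> ball 0 K \<and> Y \<subseteq> ball 0 K \<and> Z \<subseteq> ball 0 K
    \<and> ?\<mu> X = ?\<mu> ?Da \<and> ?\<mu> Y = ?\<mu> ?Db \<and> ?\<mu> Z = ?\<mu> ?Dc
    \<and> emeasure lborel (tri A B C) \<le> emeasure lborel (tri X Y Z)" for X Y Z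
  define w where "w X Y Z = ?\<mu> (X \<inter> ?Da) + ?\<mu> (Y \<inter> ?Db) + ?\<mu> (Z \<inter> ?Dc)" for X Y Z
  define tot where "tot = ?\<mu> ?Da + ?\<mu> ?Db + ?\<mu> ?Dc"
  define \<Omega> where "\<Omega> = {w X Y Z |X Y Z. P X Y Z}"
  have P0: "P A B C"
    using ball K a b c by (auto simp: P_def measure_def)
  have steiner: "P (steiner v X) (steiner v Y) (steiner v Z)" if "P X Y Z" "v \<noteq> 0" for X Y Z v
  proof -
    have X: "X \<in> sets borel" "Y \<in> sets borel" "Z \<in> sets borel"
        "X \<subseteq> ball 0 K" "Y \<subseteq> ball 0 K" "Z \<subseteq> ball 0 K"
        "?\<mu> X = ?\<mu> ?Da" "?\<mu> Y = ?\<mu> ?Db" "?\<mu> Z = ?\<mu> ?Dc"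
      and tri: "emeasure lborel (tri A B C) \<le> emeasure lborel (tri X Y Z)"
      using that(1) by (simp_all add: P_def)
    have "?\<mu> (steiner v S) = ?\<mu> S" if "S \<in> sets borel" "S \<subseteq> ball 0 K" for S
      using emeasure_steiner[OF that \<open>v \<noteq> 0\<close>] by (simp add: measure_def)
    moreover have "steiner v S \<subseteq> ball 0 K" if "S \<subseteq> ball 0 K" for S
      using steiner_subset_ball[OF that \<open>v \<noteq> 0\<close>] K by simp
    moreover have "emeasure lborel (tri A B C) \<le> emeasure lborel (tri (steiner v X) (steiner v Y) (steiner v Z))"
      using tri emeasure_tri_le_steiner[OF X(1-6) \<open>v \<noteq> 0\<close>] by (rule order_trans)
    ultimately show ?thesis using X by (simp add: P_def steiner_sets)
  qed
  have inter_le: "?\<mu> (X \<inter> ball 0 \<rho>) \<le> ?\<mu> (ball 0 \<rho>)" if "X \<in> sets borel" for X and \<rho> :: real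
    using that by (intro measure_mono_fmeasurable) (auto intro: fmeasurable_subset_ball)
  have le_tot: "w X Y Z \<le> tot" if "P X Y Z" for X Y Z
    using that inter_le[of X a] inter_le[of Y b] inter_le[of Z c] by (auto simp: P_def w_def tot_def)
  have bdd: "bdd_above \<Omega>" using le_tot by (auto simp: \<Omega>_def bdd_above_def)
  have ne: "\<Omega> \<noteq> {}" using P0 by (auto simp: \<Omega>_def)
  \<comment> \<open>The three defects add up to \<open>tot - w X Y Z\<close>, so one of them is at
    least \<open>d\<close>. Its direction is applied to all three sets, and the other two overlaps
    do not decrease.\<close>
  have gain: "\<exists>X' Y' Z'. P X' Y' Z' \<and> w X Y Z + d\<^sup>2 / \<kappa> \<le> w X' Y' Z'"
    if P: "P X Y Z" and d: "0 < d" "3 * d \<le> tot - w X Y Z" for X Y Z d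
  proof -
    have mono: "?\<mu> (S \<inter> ball 0 \<rho>) \<le> ?\<mu> (steiner v S \<inter> ball 0 \<rho>)"
      if "S \<in> sets borel" "S \<subseteq> ball 0 K" "v \<noteq> 0" "0 \<le> \<rho>" for S v and \<rho> :: real
      using measure_steiner_inter_ball[OF that refl] measure_nonneg[of lborel "{x \<in> ball 0 \<rho> - S. x - v \<in> S - ball 0 \<rho>}"] by linarith
    consider "d \<le> ?\<mu> ?Da - ?\<mu> (X \<inter> ?Da)" | "d \<le> ?\<mu> ?Db - ?\<mu> (Y \<inter> ?Db)" | "d \<le> ?\<mu> ?Dc - ?\<mu> (Z \<inter> ?Dc)"
      using d unfolding w_def tot_def by linarith
    then have "\<exists>v. v \<noteq> 0 \<and> w X Y Z + d\<^sup>2 / \<kappa> \<le> w (steiner v X) (steiner v Y) (steiner v Z)"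
    proof cases
      case 1
      obtain v where "v \<noteq> 0" "?\<mu> (X \<inter> ?Da) + d\<^sup>2 / \<kappa> \<le> ?\<mu> (steiner v X \<inter> ?Da)"
        using exists_steiner_gain[OF _ _ r(1) K(2) K(5) refl _ d(1) 1] P by (auto simp: P_def \<kappa>_def)
      then show ?thesis
        using mono[of Y v b] mono[of Z v c] P r by (intro exI[of _ v]) (auto simp: P_def w_def)
    next
      case 2
      obtain v where "v \<noteq> 0" "?\<mu> (Y \<inter> ?Db) + d\<^sup>2 / \<kappa> \<le> ?\<mu> (steiner v Y \<inter> ?Db)"
        using exists_steiner_gain[OF _ _ r(2) K(3) K(5) refl _ d(1) 2] P by (auto simp: P_def \<kappa>_def)
      then show ?thesis
        using mono[of X v a] mono[of Z v c] P r by (intro exI[of _ v]) (auto simp: P_def w_def)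
    next
      case 3
      obtain v where "v \<noteq> 0" "?\<mu> (Z \<inter> ?Dc) + d\<^sup>2 / \<kappa> \<le> ?\<mu> (steiner v Z \<inter> ?Dc)"
        using exists_steiner_gain[OF _ _ r(3) K(4) K(5) refl _ d(1) 3] P by (auto simp: P_def \<kappa>_def)
      then show ?thesis
        using mono[of X v a] mono[of Y v b] P r by (intro exI[of _ v]) (auto simp: P_def w_def)
    qed
    then show ?thesis using steiner[OF P] by blast
  qed
  have Sup: "tot \<le> Sup \<Omega>"
  proof (rule ccontr)
    assume "\<not> tot \<le> Sup \<Omega>"
    \<comment> \<open>Every admissible triple has defect at least \<open>tot - Sup \<Omega>\<close>,
      so a third of this gap serves as \<open>d\<close> in \<open>gain\<close> for a triple chosen
      within the gain of the supremum.\<close>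
    then have d: "0 < (tot - Sup \<Omega>) / 3" (is "0 < ?d") by simp
    have "0 < ?d\<^sup>2 / \<kappa>" using d \<kappa> by (intro divide_pos_pos zero_less_power) auto
    then have "Sup \<Omega> - ?d\<^sup>2 / \<kappa> < Sup \<Omega>" by linarith
    from less_cSupD[OF ne this] obtain y where "y \<in> \<Omega>" "Sup \<Omega> - ?d\<^sup>2 / \<kappa> < y" by blast
    then obtain X Y Z where XYZ: "P X Y Z" "Sup \<Omega> - ?d\<^sup>2 / \<kappa> < w X Y Z"
      unfolding \<Omega>_def mem_Collect_eq by blast
    have "w X Y Z \<le> Sup \<Omega>" using XYZ bdd by (intro cSup_upper) (auto simp: \<Omega>_def)
    then obtain X' Y' Z' where "P X' Y' Z'" "w X Y Z + ?d\<^sup>2 / \<kappa> \<le> w X' Y' Z'"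
      using gain[OF XYZ(1) d] by auto
    moreover from this have "w X' Y' Z' \<le> Sup \<Omega>" using bdd by (intro cSup_upper) (auto simp: \<Omega>_def)
    ultimately show False using XYZ(2) by linarith
  qed
  show ?thesis
  proof (rule ennreal_le_epsilon)
    fix e :: real assume e: "0 < e"
    \<comment> \<open>The coefficients are those of the three errors in the perturbation estimate;
      the 1 allows division when all balls are null.\<close>
    let ?s = "?\<mu> ?Db + ?\<mu> ?Da + ?\<mu> ?Da + 1"
    define \<epsilon> where "\<epsilon> = e / ?s"
    have s: "0 < ?s" by (simp add: add_nonneg_pos)
    have \<epsilon>: "0 < \<epsilon>" using e s by (simp add: \<epsilon>_def)
    have "tot - \<epsilon> < Sup \<Omega>" using Sup \<epsilon> by linarith
    from less_cSupD[OF ne this] obtain y where "y \<in> \<Omega>" "tot - \<epsilon> < y" by blast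
    then obtain X Y Z where XYZ: "P X Y Z" "tot - \<epsilon> < w X Y Z"
      unfolding \<Omega>_def mem_Collect_eq by blast
    have sets[measurable]: "X \<in> sets borel" "Y \<in> sets borel" "Z \<in> sets borel" using XYZ by (auto simp: P_def)
    \<comment> \<open>Equality of the measures of \<open>S\<close> and the ball turns a small
      missing part of the ball into an equally small surplus of \<open>S\<close> outside it.\<close>
    have def: "emeasure lborel (S - ball 0 \<rho>) \<le> ennreal \<epsilon>"
      if "S \<in> sets borel" "S \<subseteq> ball 0 K" "?\<mu> S = ?\<mu> (ball 0 \<rho>)" "?\<mu> (ball 0 \<rho>) - \<epsilon> \<le> ?\<mu> (S \<inter> ball 0 \<rho>)" for S \<rho>
    proof -
      have "S - ball 0 \<rho> = S - S \<inter> ball 0 \<rho>" by auto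
      moreover have "?\<mu> (S - S \<inter> ball 0 \<rho>) = ?\<mu> S - ?\<mu> (S \<inter> ball 0 \<rho>)"
        using that by (intro measurable_measure_Diff) (auto intro: fmeasurable_subset_ball[of _ K])
      ultimately have "?\<mu> (S - ball 0 \<rho>) \<le> \<epsilon>" using that by simp
      moreover have "emeasure lborel (S - ball 0 \<rho>) = ennreal (?\<mu> (S - ball 0 \<rho>))"
        using that by (intro emeasure_subset_ball[of _ K]) auto
      ultimately show ?thesis by (simp add: ennreal_leI)
    qed
    have def': "emeasure lborel (X - ?Da) \<le> ennreal \<epsilon>" "emeasure lborel (Y - ?Db) \<le> ennreal \<epsilon>" "emeasure lborel (Z - ?Dc) \<le> ennreal \<epsilon>"
      using XYZ inter_le[OF sets(1), of a] inter_le[OF sets(2), of b] inter_le[OF sets(3), of c]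
      by (auto simp: P_def w_def tot_def intro!: def)
    have em: "emeasure lborel X = ennreal (?\<mu> ?Da)" "emeasure lborel Y = ennreal (?\<mu> ?Db)"
      using XYZ by (auto simp: P_def emeasure_subset_ball[of _ K])
    have "emeasure lborel (tri A B C) \<le> emeasure lborel (tri X Y Z)" using XYZ by (simp add: P_def)
    also have "\<dots> \<le> emeasure lborel (tri ?Da ?Db ?Dc)
      + (emeasure lborel (X - ?Da) * emeasure lborel Y + (emeasure lborel X * emeasure lborel (Y - ?Db)
      + emeasure lborel X * emeasure lborel (Z - ?Dc)))"
      by (rule emeasure_tri_perturb) auto
    also have "\<dots> \<le> emeasure lborel (tri ?Da ?Db ?Dc)
      + (ennreal \<epsilon> * ennreal (?\<mu> ?Db) + (ennreal (?\<mu> ?Da) * ennreal \<epsilon> + ennreal (?\<mu> ?Da) * ennreal \<epsilon>))"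
      unfolding em by (intro add_left_mono add_mono mult_mono def') auto
    also have "ennreal \<epsilon> * ennreal (?\<mu> ?Db) + (ennreal (?\<mu> ?Da) * ennreal \<epsilon> + ennreal (?\<mu> ?Da) * ennreal \<epsilon>)
      = ennreal (\<epsilon> * ?\<mu> ?Db + (?\<mu> ?Da * \<epsilon> + ?\<mu> ?Da * \<epsilon>))"
      using \<epsilon> by (simp only: ennreal_mult ennreal_plus measure_nonneg less_imp_le mult_nonneg_nonneg add_nonneg_nonneg)
    also have "emeasure lborel (tri ?Da ?Db ?Dc) + ennreal (\<epsilon> * ?\<mu> ?Db + (?\<mu> ?Da * \<epsilon> + ?\<mu> ?Da * \<epsilon>))
      \<le> emeasure lborel (tri ?Da ?Db ?Dc) + ennreal e"
    proof (intro add_left_mono ennreal_leI)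
      have "\<epsilon> * ?\<mu> ?Db + (?\<mu> ?Da * \<epsilon> + ?\<mu> ?Da * \<epsilon>) \<le> \<epsilon> * ?s"
        using \<epsilon> by (simp add: algebra_simps)
      also have "\<dots> = e" using s by (simp add: \<epsilon>_def)
      finally show "\<epsilon> * ?\<mu> ?Db + (?\<mu> ?Da * \<epsilon> + ?\<mu> ?Da * \<epsilon>) \<le> e" .
    qed
    finally show "emeasure lborel (tri A B C) \<le> emeasure lborel (tri ?Da ?Db ?Dc) + ennreal e" .
  qed
qed

lemma exists_ball_emeasure_eq:
  assumes "m < \<infinity>"
  shows "\<exists>r\<ge>0. emeasure lborel (ball (0::'a::euclidean_space) r) = m"
proof -
  obtain q where q: "0 \<le> q" "m = ennreal q" using assms by (cases m) auto
  let ?c = "unit_ball_vol (real DIM('a))"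
  have "?c \<noteq> 0" by (rule less_imp_neq[THEN not_sym]) simp
  then have "emeasure lborel (ball (0::'a) (root DIM('a) (q / ?c))) = m"
    using q by (simp add: emeasure_ball)
  then show ?thesis using q by (intro exI[of _ "root DIM('a) (q / ?c)"]) simp
qed

lemma ball_radius_le:
  assumes "0 \<le> r" "emeasure lborel (ball (0::'a::euclidean_space) r) \<le> emeasure lborel (ball (0::'a) r')" "0 \<le> r'"
  shows "r \<le> r'"
proof -
  have "unit_ball_vol (real DIM('a)) * r ^ DIM('a) \<le> unit_ball_vol (real DIM('a)) * r' ^ DIM('a)"
    using assms by (simp add: emeasure_ball)
  then show ?thesis using assms by (simp add: power_mono_iff)
qed

text \<open>Cutting the sets to \<open>ball 0 n\<close> only shrinks the corresponding centred
  balls, so the bounded case bounds every truncation by one fixed quantity. Continuity from below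
  removes the truncation.\<close>

theorem riesz_sets:
  fixes A B C :: "'a::euclidean_space set"
  assumes [measurable]: "A \<in> sets borel" "B \<in> sets borel" "C \<in> sets borel"
    and r: "0 \<le> a" "0 \<le> b" "0 \<le> c"
    and a: "emeasure lborel (ball (0::'a) a) = emeasure lborel A"
    and b: "emeasure lborel (ball (0::'a) b) = emeasure lborel B"
    and c: "emeasure lborel (ball (0::'a) c) = emeasure lborel C"
  shows "emeasure lborel (tri A B C) \<le> emeasure lborel (tri (ball (0::'a) a) (ball 0 b) (ball 0 c))"
proof -
  let ?T = "\<lambda>n::nat. tri (A \<inter> ball 0 (real n)) (B \<inter> ball 0 (real n)) (C \<inter> ball 0 (real n))"
  have le: "emeasure lborel (?T n) \<le> emeasure lborel (tri (ball (0::'a) a) (ball 0 b) (ball 0 c))" for n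
  proof -
    have ex: "\<exists>q. 0 \<le> q \<and> q \<le> \<rho> \<and> emeasure lborel (ball (0::'a) q) = emeasure lborel (S \<inter> ball 0 (real n))"
      if [measurable]: "S \<in> sets borel" and "0 \<le> \<rho>" "emeasure lborel (ball (0::'a) \<rho>) = emeasure lborel S" for S and \<rho> :: real
    proof -
      have le: "emeasure lborel (S \<inter> ball 0 (real n)) \<le> emeasure lborel (ball (0::'a) \<rho>)"
        using that by (auto intro!: emeasure_mono)
      then obtain q where q: "0 \<le> q" "emeasure lborel (ball (0::'a) q) = emeasure lborel (S \<inter> ball 0 (real n))"
        using exists_ball_emeasure_eq[where 'a = 'a, of "emeasure lborel (S \<inter> ball 0 (real n))"]
          emeasure_lborel_ball_finite[of "0::'a" \<rho>] by (auto intro: le_less_trans)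
      have "q \<le> \<rho>"
        by (rule ball_radius_le[where 'a = 'a, OF q(1) _ that(2)]) (simp only: q(2) le)
      then show ?thesis using q by blast
    qed
    obtain a' where a': "0 \<le> a'" "a' \<le> a" "emeasure lborel (ball (0::'a) a') = emeasure lborel (A \<inter> ball 0 (real n))"
      using ex[OF _ r(1) a] by auto
    obtain b' where b': "0 \<le> b'" "b' \<le> b" "emeasure lborel (ball (0::'a) b') = emeasure lborel (B \<inter> ball 0 (real n))"
      using ex[OF _ r(2) b] by auto
    obtain c' where c': "0 \<le> c'" "c' \<le> c" "emeasure lborel (ball (0::'a) c') = emeasure lborel (C \<inter> ball 0 (real n))"
      using ex[OF _ r(3) c] by auto
    have "emeasure lborel (?T n) \<le> emeasure lborel (tri (ball (0::'a) a') (ball 0 b') (ball 0 c'))"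
      by (rule riesz_bounded[of _ _ _ "real n"]) (use a' b' c' in auto)
    also have "\<dots> \<le> emeasure lborel (tri (ball (0::'a) a) (ball 0 b) (ball 0 c))"
    proof (rule emeasure_mono)
      show "tri (ball 0 a') (ball 0 b') (ball 0 c') \<subseteq> tri (ball 0 a) (ball 0 b) (ball 0 c)"
        using a' b' c' by (auto simp: tri_def)
    qed auto
    finally show ?thesis .
  qed
  have "tri A B C = (\<Union>n. ?T n)"
  proof (intro equalityI subsetI)
    fix p assume p: "p \<in> tri A B C"
    obtain s t where st: "p = (s, t)" by (cases p)
    obtain n where "max (norm s) (max (norm t) (norm (s + t))) < real n"
      using reals_Archimedean2 by blast
    then show "p \<in> (\<Union>n. ?T n)" using p st by (auto simp: tri_def)
  qed (auto simp: tri_def)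
  moreover have "emeasure lborel (\<Union>n. ?T n) = (SUP n. emeasure lborel (?T n))"
  proof (rule SUP_emeasure_incseq[symmetric])
    show "incseq ?T" by (force simp: incseq_def tri_def)
  qed auto
  ultimately show ?thesis using le by (auto intro: SUP_least)
qed

subsection \<open>From sets to functions\<close>

text \<open>The exceptional pairs form \<open>tri N UNIV UNIV\<close>, whose measure is the product
  of 0 and \<infinity>, hence 0 in \<open>ennreal\<close>.\<close>

lemma AE_lborel_fst:
  assumes "AE x in lborel. P (x :: 'a::euclidean_space)"
  shows "AE p in (lborel :: ('a \<times> 'a) measure). P (fst p)"
proof -
  obtain N where N: "{x \<in> space lborel. \<not> P x} \<subseteq> N" "emeasure lborel N = 0" "N \<in> sets lborel"
    using assms by (rule AE_E)
  have "emeasure lborel (tri N UNIV UNIV) = 0" using N by (subst emeasure_tri_UNIV) auto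
  moreover have "tri N UNIV UNIV \<in> sets borel" using N by (intro tri_sets) auto
  ultimately show ?thesis
    using N by (intro AE_I[where N = "tri N UNIV UNIV"]) (auto simp: tri_def)
qed

lemma AE_lborel_snd:
  assumes "AE x in lborel. P (x :: 'a::euclidean_space)"
  shows "AE p in (lborel :: ('a \<times> 'a) measure). P (snd p)"
proof -
  obtain N where N: "{x \<in> space lborel. \<not> P x} \<subseteq> N" "emeasure lborel N = 0" "N \<in> sets lborel"
    using assms by (rule AE_E)
  have eq: "tri UNIV N UNIV = UNIV \<times> N" by (auto simp: tri_def)
  have "emeasure lborel (tri UNIV N UNIV) = 0" unfolding eq using N by (subst emeasure_times) auto
  moreover have "tri UNIV N UNIV \<in> sets borel" using N by (intro tri_sets) auto
  ultimately show ?thesis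
    using N by (intro AE_I[where N = "tri UNIV N UNIV"]) (auto simp: tri_def)
qed

lemma AE_lborel_fst_plus_snd:
  assumes "AE x in lborel. P (x :: 'a::euclidean_space)"
  shows "AE p in (lborel :: ('a \<times> 'a) measure). P (fst p + snd p)"
proof -
  obtain N where N: "{x \<in> space lborel. \<not> P x} \<subseteq> N" "emeasure lborel N = 0" "N \<in> sets lborel"
    using assms by (rule AE_E)
  have "emeasure lborel (tri UNIV UNIV N) = 0" using N by (subst emeasure_tri_UNIV) auto
  moreover have "tri UNIV UNIV N \<in> sets borel" using N by (intro tri_sets) auto
  ultimately show ?thesis
    using N by (intro AE_I[where N = "tri UNIV UNIV N"]) (auto simp: tri_def)
qed

text \<open>This isolates what the argument uses of a rearrangement with finite real values.
  Containment of the ball holds almost everywhere because a value \<infinity> at the origin is lost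
  in passing to reals. Levels are positive, since at level 0 the superlevel set is the whole
  space.\<close>

definition ball_rearrangement :: "('a::euclidean_space \<Rightarrow> real) \<Rightarrow> ('a \<Rightarrow> real) \<Rightarrow> bool" where
  "ball_rearrangement f u \<longleftrightarrow> f \<in> borel_measurable borel \<and> u \<in> borel_measurable borel \<and>
    (\<forall>x. 0 \<le> f x) \<and> (\<forall>x. 0 \<le> u x) \<and>
    (\<forall>l>0. emeasure lborel {x. l \<le> f x} < \<infinity> \<and> emeasure lborel {x. l \<le> u x} = emeasure lborel {x. l \<le> f x} \<and>
      (\<exists>r\<ge>0. emeasure lborel (ball (0::'a) r) = emeasure lborel {x. l \<le> f x} \<and>
        (AE x in lborel. x \<in> ball 0 r \<longrightarrow> l \<le> u x)))"

lemma ball_rearrangementD: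
  assumes "ball_rearrangement f u"
  shows "f \<in> borel_measurable borel" "u \<in> borel_measurable borel" "0 \<le> f x" "0 \<le> u x"
    "0 < l \<Longrightarrow> emeasure lborel {x. l \<le> f x} < \<infinity>"
    "0 < l \<Longrightarrow> emeasure lborel {x. l \<le> u x} = emeasure lborel {x. l \<le> f x}"
  using assms by (auto simp: ball_rearrangement_def)

lemma superlevel_sets [measurable]:
  fixes f :: "'a::euclidean_space \<Rightarrow> real"
  assumes [measurable]: "f \<in> borel_measurable borel"
  shows "{x. l \<le> f x} \<in> sets borel"
proof -
  have "{x \<in> space borel. l \<le> f x} \<in> sets borel" by measurable
  then show ?thesis by simp
qed

lemma riesz_superlevel:
  fixes f g h u v w :: "'a::euclidean_space \<Rightarrow> real"
  assumes fu: "ball_rearrangement f u" and gv: "ball_rearrangement g v" and hw: "ball_rearrangement h w"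
    and l: "0 < i" "0 < j" "0 < k"
  shows "emeasure lborel (tri {x. i \<le> f x} {x. j \<le> g x} {x. k \<le> h x})
    \<le> emeasure lborel (tri {x. i \<le> u x} {x. j \<le> v x} {x. k \<le> w x})"
proof -
  note [measurable] = ball_rearrangementD(1,2)[OF fu] ball_rearrangementD(1,2)[OF gv] ball_rearrangementD(1,2)[OF hw]
  obtain a where a: "0 \<le> a" "emeasure lborel (ball (0::'a) a) = emeasure lborel {x. i \<le> f x}"
      "AE x in lborel. x \<in> ball 0 a \<longrightarrow> i \<le> u x"
    using fu l unfolding ball_rearrangement_def by blast
  obtain b where b: "0 \<le> b" "emeasure lborel (ball (0::'a) b) = emeasure lborel {x. j \<le> g x}"
      "AE x in lborel. x \<in> ball 0 b \<longrightarrow> j \<le> v x"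
    using gv l unfolding ball_rearrangement_def by blast
  obtain c where c: "0 \<le> c" "emeasure lborel (ball (0::'a) c) = emeasure lborel {x. k \<le> h x}"
      "AE x in lborel. x \<in> ball 0 c \<longrightarrow> k \<le> w x"
    using hw l unfolding ball_rearrangement_def by blast
  have "emeasure lborel (tri {x. i \<le> f x} {x. j \<le> g x} {x. k \<le> h x})
    \<le> emeasure lborel (tri (ball (0::'a) a) (ball 0 b) (ball 0 c))"
    by (rule riesz_sets) (use a b c in auto)
  also have "\<dots> \<le> emeasure lborel (tri {x. i \<le> u x} {x. j \<le> v x} {x. k \<le> w x})"
  proof (rule emeasure_mono_AE)
    show "AE p in lborel. p \<in> tri (ball (0::'a) a) (ball 0 b) (ball 0 c) \<longrightarrow> p \<in> tri {x. i \<le> u x} {x. j \<le> v x} {x. k \<le> w x}"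
      using AE_lborel_fst[OF a(3)] AE_lborel_snd[OF b(3)] AE_lborel_fst_plus_snd[OF c(3)]
      by eventually_elim (auto simp: tri_def)
  qed auto
  finally show ?thesis .
qed

section \<open>Discretization of the mixed difference\<close>

text \<open>Dividing the index by \<open>n + 1\<close> rounds \<open>x\<close> down to a multiple of
  the mesh width and truncates it at height \<open>n + 1\<close>. The cap \<open>(n + 1)^2\<close>
  makes all layer sums finite, with a range independent of \<open>x\<close>.\<close>

definition grid_index :: "nat \<Rightarrow> real \<Rightarrow> nat" where
  "grid_index n x = min ((n + 1)\<^sup>2) (nat \<lfloor>real (n + 1) * x\<rfloor>)"

text \<open>This converts a summation bound into a superlevel condition at the upper end of the
  cell. Taking the upper end keeps every level positive, as the finite distribution functions
  require.\<close>

lemma less_grid_index_iff: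
  assumes "0 \<le> x"
  shows "i < grid_index n x \<longleftrightarrow> i < (n + 1)\<^sup>2 \<and> real (i + 1) / real (n + 1) \<le> x"
proof -
  have "i < nat \<lfloor>real (n + 1) * x\<rfloor> \<longleftrightarrow> real (i + 1) \<le> real (n + 1) * x"
    using assms by (simp add: zless_nat_eq_int_zless less_floor_iff) linarith
  also have "\<dots> \<longleftrightarrow> real (i + 1) / real (n + 1) \<le> x"
    by (simp add: divide_le_eq mult.commute)
  finally show ?thesis by (simp add: grid_index_def)
qed

lemma grid_index_le:
  assumes "0 \<le> x"
  shows "real (grid_index n x) / real (n + 1) \<le> x"
proof -
  have "real (grid_index n x) \<le> real (nat \<lfloor>real (n + 1) * x\<rfloor>)" by (simp add: grid_index_def)
  also have "\<dots> \<le> real (n + 1) * x" using assms by (simp add: of_nat_nat)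
  finally show ?thesis by (simp add: divide_le_eq mult.commute)
qed

lemma grid_index_tendsto:
  assumes x: "0 \<le> x"
  shows "(\<lambda>n. real (grid_index n x) / real (n + 1)) \<longlonglongrightarrow> x"
proof (rule tendsto_sandwich)
  show "\<forall>\<^sub>F n in sequentially. x - 1 / real (n + 1) \<le> real (grid_index n x) / real (n + 1)"
  proof (rule eventually_sequentiallyI)
    fix n assume n: "nat \<lceil>x\<rceil> \<le> n"
    \<comment> \<open>From here on the cap is inactive, and the floor loses at most one mesh
      width.\<close>
    have "x \<le> real (n + 1)" using n by linarith
    then have "real (n + 1) * x \<le> real (n + 1) * real (n + 1)" by (intro mult_left_mono) auto
    then have "real (n + 1) * x \<le> real ((n + 1)\<^sup>2)" by (simp only: power2_eq_square of_nat_mult)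
    then have "\<lfloor>real (n + 1) * x\<rfloor> \<le> \<lfloor>real ((n + 1)\<^sup>2)\<rfloor>" by (rule floor_mono)
    then have "\<lfloor>real (n + 1) * x\<rfloor> \<le> int ((n + 1)\<^sup>2)" by (simp only: floor_of_nat)
    then have "nat \<lfloor>real (n + 1) * x\<rfloor> \<le> (n + 1)\<^sup>2" by (simp only: nat_le_iff)
    then have "grid_index n x = nat \<lfloor>real (n + 1) * x\<rfloor>" by (simp only: grid_index_def min.absorb2)
    then have "real (n + 1) * x - 1 \<le> real (grid_index n x)" using x by linarith
    then have "(real (n + 1) * x - 1) / real (n + 1) \<le> real (grid_index n x) / real (n + 1)"
      by (rule divide_right_mono) simp
    then show "x - 1 / real (n + 1) \<le> real (grid_index n x) / real (n + 1)"
      by (simp add: diff_divide_distrib)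
  qed
  show "\<forall>\<^sub>F n in sequentially. real (grid_index n x) / real (n + 1) \<le> x"
    using grid_index_le[OF x] by (intro always_eventually allI)
  have "(\<lambda>n. 1 / real (n + 1)) \<longlonglongrightarrow> 0" using LIMSEQ_inverse_real_of_nat by (simp add: inverse_eq_divide)
  from tendsto_diff[OF tendsto_const[of x] this] show "(\<lambda>n. x - 1 / real (n + 1)) \<longlonglongrightarrow> x" by simp
qed simp

text \<open>The mixed difference is additive when one edge of the box is subdivided, so the sums
  telescope one variable at a time.\<close>

lemma Delta3_sum:
  fixes X :: "nat \<Rightarrow> real"
  shows "Delta3 F (X 0) (X a) (X 0) (X b) (X 0) (X c)
    = (\<Sum>i<a. \<Sum>j<b. \<Sum>k<c. Delta3 F (X i) (X (Suc i)) (X j) (X (Suc j)) (X k) (X (Suc k)))"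
proof -
  have "(\<Sum>k<c. Delta3 F x x' y y' (X k) (X (Suc k))) = Delta3 F x x' y y' (X 0) (X c)" for x x' y y'
    by (induction c) (auto simp: Delta3_def)
  moreover have "(\<Sum>j<b. Delta3 F x x' (X j) (X (Suc j)) z z') = Delta3 F x x' (X 0) (X b) z z'" for x x' z z'
    by (induction b) (auto simp: Delta3_def)
  moreover have "(\<Sum>i<a. Delta3 F (X i) (X (Suc i)) y y' z z') = Delta3 F (X 0) (X a) y y' z z'" for y y' z z'
    by (induction a) (auto simp: Delta3_def)
  ultimately show ?thesis by simp
qed

text \<open>Lengthening the three edges in turn adds three boxes, each with nonnegative mixed
  difference. This keeps the discretized integrand below the true one.\<close>

lemma Delta3_mono:
  assumes pos: "\<And>a b c d' e e'. a \<le> b \<Longrightarrow> c \<le> d' \<Longrightarrow> e \<le> e' \<Longrightarrow> 0 \<le> Delta3 F a b c d' e e'"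
    and "0 \<le> x" "x \<le> x'" "0 \<le> y" "y \<le> y'" "0 \<le> z" "z \<le> z'"
  shows "Delta3 F 0 x 0 y 0 z \<le> Delta3 F 0 x' 0 y' 0 z'"
proof -
  have "Delta3 F 0 x' 0 y' 0 z' - Delta3 F 0 x 0 y 0 z
    = Delta3 F x x' 0 y' 0 z' + Delta3 F 0 x y y' 0 z' + Delta3 F 0 x 0 y z z'"
    by (simp add: Delta3_def)
  moreover have "0 \<le> Delta3 F x x' 0 y' 0 z'" "0 \<le> Delta3 F 0 x y y' 0 z'" "0 \<le> Delta3 F 0 x 0 y z z'"
    using assms by (auto intro!: pos)
  ultimately show ?thesis by linarith
qed

text \<open>A discrete layer-cake formula: a grid cell contributes its mixed difference exactly when
  its upper corner lies below the three function values, that is, when the pair belongs to a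
  \<open>tri\<close> of superlevel sets.\<close>

lemma ennreal_Delta3_grid:
  fixes f g h :: "'a::euclidean_space \<Rightarrow> real"
  assumes pos: "\<And>a b c d' e e'. a \<le> b \<Longrightarrow> c \<le> d' \<Longrightarrow> e \<le> e' \<Longrightarrow> 0 \<le> Delta3 F a b c d' e e'"
    and nonneg: "\<And>x. 0 \<le> f x" "\<And>x. 0 \<le> g x" "\<And>x. 0 \<le> h x"
  defines "X \<equiv> \<lambda>n i. real i / real (n + 1)"
  shows "ennreal (Delta3 F 0 (X n (grid_index n (f (fst p)))) 0 (X n (grid_index n (g (snd p))))
      0 (X n (grid_index n (h (fst p + snd p)))))
    = (\<Sum>i<(n + 1)\<^sup>2. \<Sum>j<(n + 1)\<^sup>2. \<Sum>k<(n + 1)\<^sup>2.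
        ennreal (Delta3 F (X n i) (X n (Suc i)) (X n j) (X n (Suc j)) (X n k) (X n (Suc k))) *
        indicator (tri {x. X n (Suc i) \<le> f x} {x. X n (Suc j) \<le> g x} {x. X n (Suc k) \<le> h x}) p)"
proof -
  define N where "N = (n + 1)\<^sup>2"
  define \<delta> where "\<delta> i j k = Delta3 F (X n i) (X n (Suc i)) (X n j) (X n (Suc j)) (X n k) (X n (Suc k))" for i j k
  have \<delta>: "0 \<le> \<delta> i j k" for i j k
    unfolding \<delta>_def X_def by (intro pos divide_right_mono) auto
  let ?a = "grid_index n (f (fst p))" and ?b = "grid_index n (g (snd p))" and ?c = "grid_index n (h (fst p + snd p))"
  define \<eta> where "\<eta> i j k = (if i < ?a \<and> j < ?b \<and> k < ?c then \<delta> i j k else 0)" for i j k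
  have \<eta>: "0 \<le> \<eta> i j k" for i j k by (simp add: \<eta>_def \<delta>)
  have le: "grid_index n x \<le> N" for x by (simp add: grid_index_def N_def)
  \<comment> \<open>Extending the sums to a common range moves the dependence on \<open>p\<close>
    from the summation bounds into the summand, where it becomes an indicator.\<close>
  have restrict: "(\<Sum>i<grid_index n x. \<phi> i) = (\<Sum>i<N. if i < grid_index n x then \<phi> i else 0)" for x and \<phi> :: "nat \<Rightarrow> real"
    using le[of x] by (intro sum.mono_neutral_cong_left) auto
  have X0: "X n 0 = 0" by (simp add: X_def)
  have "Delta3 F 0 (X n ?a) 0 (X n ?b) 0 (X n ?c) = (\<Sum>i<?a. \<Sum>j<?b. \<Sum>k<?c. \<delta> i j k)"
    using Delta3_sum[of F "X n" ?a ?b ?c] by (simp add: X0 \<delta>_def)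
  also have "\<dots> = (\<Sum>i<N. \<Sum>j<N. \<Sum>k<N. \<eta> i j k)"
    unfolding restrict \<eta>_def by (intro sum.cong refl) (auto intro!: sum.cong sum.neutral)
  also have "ennreal \<dots> = (\<Sum>i<N. \<Sum>j<N. \<Sum>k<N. ennreal (\<eta> i j k))"
    by (simp add: \<eta> sum_nonneg)
  also have "\<dots> = (\<Sum>i<N. \<Sum>j<N. \<Sum>k<N. ennreal (\<delta> i j k) *
        indicator (tri {x. X n (Suc i) \<le> f x} {x. X n (Suc j) \<le> g x} {x. X n (Suc k) \<le> h x}) p)"
  proof (intro sum.cong refl)
    fix i j k assume "i \<in> {..<N}" "j \<in> {..<N}" "k \<in> {..<N}"
    then have "i < ?a \<and> j < ?b \<and> k < ?c \<longleftrightarrow>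
      p \<in> tri {x. X n (Suc i) \<le> f x} {x. X n (Suc j) \<le> g x} {x. X n (Suc k) \<le> h x}"
      by (cases p) (simp add: less_grid_index_iff nonneg tri_def X_def N_def)
    then show "ennreal (\<eta> i j k) = ennreal (\<delta> i j k) *
        indicator (tri {x. X n (Suc i) \<le> f x} {x. X n (Suc j) \<le> g x} {x. X n (Suc k) \<le> h x}) p"
      by (auto simp: indicator_def \<eta>_def)
  qed
  finally show ?thesis by (simp add: N_def \<delta>_def)
qed

lemma nn_integral_sum3_indicator:
  assumes "\<And>i j k. T i j k \<in> sets M"
  shows "(\<integral>\<^sup>+p. (\<Sum>i\<in>I. \<Sum>j\<in>J. \<Sum>k\<in>K. c i j k * indicator (T i j k) p) \<partial>M)
    = (\<Sum>i\<in>I. \<Sum>j\<in>J. \<Sum>k\<in>K. c i j k * emeasure M (T i j k))"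
  using assms by (simp add: nn_integral_sum nn_integral_cmult_indicator)

text \<open>The grids for successive \<open>n\<close> are not nested, so monotone convergence is not
  at hand. Instead, continuity and Fatou's lemma handle the original functions, and
  \<open>Delta3_mono\<close> bounds the discretized rearranged integrand by its limit for every
  \<open>n\<close>. In between, the set inequality is summed with nonnegative weights.\<close>

proposition riesz_Delta3:
  fixes f g h u v w :: "'a::euclidean_space \<Rightarrow> real"
  assumes cont: "continuous_on UNIV F"
    and pos: "\<And>a b c d' e e'. a \<le> b \<Longrightarrow> c \<le> d' \<Longrightarrow> e \<le> e' \<Longrightarrow> 0 \<le> Delta3 F a b c d' e e'"
    and fu: "ball_rearrangement f u" and gv: "ball_rearrangement g v" and hw: "ball_rearrangement h w"
  shows "(\<integral>\<^sup>+p. ennreal (Delta3 F 0 (f (fst p)) 0 (g (snd p)) 0 (h (fst p + snd p))) \<partial>lborel)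
    \<le> (\<integral>\<^sup>+p. ennreal (Delta3 F 0 (u (fst p)) 0 (v (snd p)) 0 (w (fst p + snd p))) \<partial>lborel)"
proof -
  note [measurable] = ball_rearrangementD(1,2)[OF fu] ball_rearrangementD(1,2)[OF gv] ball_rearrangementD(1,2)[OF hw]
  define X where "X n i = real i / real (n + 1)" for n i :: nat
  define \<delta> where "\<delta> n i j k = ennreal (Delta3 F (X n i) (X n (Suc i)) (X n j) (X n (Suc j)) (X n k) (X n (Suc k)))" for n i j k
  define T where "T f g h n i j k = tri {x. X n (Suc i) \<le> f x} {x. X n (Suc j) \<le> g x} {x. X n (Suc k) \<le> h x}"
    for f g h :: "'a \<Rightarrow> real" and n i j k
  define S where "S f g h n p = ennreal (Delta3 F 0 (X n (grid_index n (f (fst p)))) 0 (X n (grid_index n (g (snd p))))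
      0 (X n (grid_index n (h (fst p + snd p)))))" for f g h :: "'a \<Rightarrow> real" and n p
  have Suc_pos: "0 < X n (Suc i)" for n i by (simp add: X_def)
  have S_eq: "S f g h n p = (\<Sum>i<(n + 1)\<^sup>2. \<Sum>j<(n + 1)\<^sup>2. \<Sum>k<(n + 1)\<^sup>2. \<delta> n i j k * indicator (T f g h n i j k) p)"
    if "\<And>x. 0 \<le> f x" "\<And>x. 0 \<le> g x" "\<And>x. 0 \<le> h x" for f g h n p
    using ennreal_Delta3_grid[OF pos that, where n = n and p = p] by (simp add: S_def \<delta>_def T_def X_def)
  have T_sets[measurable]: "T f g h n i j k \<in> sets borel"
    if "f \<in> borel_measurable borel" "g \<in> borel_measurable borel" "h \<in> borel_measurable borel" for f g h n i j k
    using that unfolding T_def by measurable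
  have S_int: "(\<integral>\<^sup>+p. S f g h n p \<partial>lborel) = (\<Sum>i<(n + 1)\<^sup>2. \<Sum>j<(n + 1)\<^sup>2. \<Sum>k<(n + 1)\<^sup>2. \<delta> n i j k * emeasure lborel (T f g h n i j k))"
    if [measurable]: "f \<in> borel_measurable borel" "g \<in> borel_measurable borel" "h \<in> borel_measurable borel"
      and nn: "\<And>x. 0 \<le> f x" "\<And>x. 0 \<le> g x" "\<And>x. 0 \<le> h x" for f g h n
    unfolding S_eq[OF nn] by (intro nn_integral_sum3_indicator) (simp add: T_sets that)
  have lim: "(\<lambda>n. S f g h n p) \<longlonglongrightarrow> ennreal (Delta3 F 0 (f (fst p)) 0 (g (snd p)) 0 (h (fst p + snd p)))" for p
  proof -
    have "(\<lambda>n. F (a n, b n, c n)) \<longlonglongrightarrow> F (a', b', c')"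
      if "a \<longlonglongrightarrow> a'" "b \<longlonglongrightarrow> b'" "c \<longlonglongrightarrow> c'" for a b c a' b' c'
      using cont that by (intro continuous_on_tendsto_compose[OF cont]) (auto intro!: tendsto_Pair)
    moreover have "(\<lambda>n. X n (grid_index n x)) \<longlonglongrightarrow> x" if "0 \<le> x" for x
      using grid_index_tendsto[OF that] by (simp add: X_def)
    ultimately show ?thesis
      unfolding S_def Delta3_def
      using ball_rearrangementD(3)[OF fu] ball_rearrangementD(3)[OF gv] ball_rearrangementD(3)[OF hw]
      by (intro tendsto_ennrealI tendsto_intros) auto
  qed
  have le: "S u v w n p \<le> ennreal (Delta3 F 0 (u (fst p)) 0 (v (snd p)) 0 (w (fst p + snd p)))" for n p
    unfolding S_def X_def
    using ball_rearrangementD(4)[OF fu] ball_rearrangementD(4)[OF gv] ball_rearrangementD(4)[OF hw]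
    by (intro ennreal_leI Delta3_mono pos grid_index_le) auto
  have meas: "S f g h n \<in> borel_measurable lborel" for n
  proof -
    have "S f g h n = (\<lambda>p. \<Sum>i<(n + 1)\<^sup>2. \<Sum>j<(n + 1)\<^sup>2. \<Sum>k<(n + 1)\<^sup>2. \<delta> n i j k * indicator (T f g h n i j k) p)"
      using ball_rearrangementD(3)[OF fu] ball_rearrangementD(3)[OF gv] ball_rearrangementD(3)[OF hw]
      by (intro ext S_eq)
    also have "\<dots> \<in> borel_measurable lborel" by measurable
    finally show ?thesis .
  qed
  have "(\<integral>\<^sup>+p. ennreal (Delta3 F 0 (f (fst p)) 0 (g (snd p)) 0 (h (fst p + snd p))) \<partial>lborel)
    = (\<integral>\<^sup>+p. liminf (\<lambda>n. S f g h n p) \<partial>lborel)"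
    by (intro nn_integral_cong lim_imp_Liminf[symmetric] lim trivial_limit_sequentially)
  also have "\<dots> \<le> liminf (\<lambda>n. \<integral>\<^sup>+p. S f g h n p \<partial>lborel)"
    by (rule nn_integral_liminf[OF meas])
  also have "\<dots> \<le> liminf (\<lambda>n::nat. \<integral>\<^sup>+p. ennreal (Delta3 F 0 (u (fst p)) 0 (v (snd p)) 0 (w (fst p + snd p))) \<partial>lborel)"
  proof (intro Liminf_mono always_eventually allI)
    fix n
    have "(\<integral>\<^sup>+p. S f g h n p \<partial>lborel) \<le> (\<integral>\<^sup>+p. S u v w n p \<partial>lborel)"
    proof -
      have "(\<Sum>i<(n + 1)\<^sup>2. \<Sum>j<(n + 1)\<^sup>2. \<Sum>k<(n + 1)\<^sup>2. \<delta> n i j k * emeasure lborel (T f g h n i j k))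
        \<le> (\<Sum>i<(n + 1)\<^sup>2. \<Sum>j<(n + 1)\<^sup>2. \<Sum>k<(n + 1)\<^sup>2. \<delta> n i j k * emeasure lborel (T u v w n i j k))"
        unfolding T_def by (intro sum_mono mult_left_mono riesz_superlevel[OF fu gv hw] Suc_pos) auto
      then show ?thesis
        using ball_rearrangementD(3,4)[OF fu] ball_rearrangementD(3,4)[OF gv] ball_rearrangementD(3,4)[OF hw]
        by (simp only: S_int ball_rearrangementD(1,2)[OF fu] ball_rearrangementD(1,2)[OF gv] ball_rearrangementD(1,2)[OF hw])
    qed
    also have "\<dots> \<le> (\<integral>\<^sup>+p. ennreal (Delta3 F 0 (u (fst p)) 0 (v (snd p)) 0 (w (fst p + snd p))) \<partial>lborel)"
      by (intro nn_integral_mono le)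
    finally show "(\<integral>\<^sup>+p. S f g h n p \<partial>lborel)
      \<le> (\<integral>\<^sup>+p. ennreal (Delta3 F 0 (u (fst p)) 0 (v (snd p)) 0 (w (fst p + snd p))) \<partial>lborel)" .
  qed
  also have "\<dots> = (\<integral>\<^sup>+p. ennreal (Delta3 F 0 (u (fst p)) 0 (v (snd p)) 0 (w (fst p + snd p))) \<partial>lborel)"
    by (rule Liminf_const) simp
  finally show ?thesis .
qed

subsection \<open>Equimeasurability and boundary terms\<close>

text \<open>Distribution functions use \<open>\<le>\<close>, while measures on the line are compared
  below on open half-lines \<open>{y<..}\<close>; this links the two.\<close>

lemma emeasure_strict_superlevel:
  fixes f :: "'a::euclidean_space \<Rightarrow> real"
  assumes [measurable]: "f \<in> borel_measurable borel"
  shows "emeasure lborel {x. y < f x} = (SUP n. emeasure lborel {x. y + 1 / real (Suc n) \<le> f x})"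
proof -
  have "{x. y < f x} = (\<Union>n. {x. y + 1 / real (Suc n) \<le> f x})"
  proof (intro equalityI subsetI)
    fix x assume "x \<in> {x. y < f x}"
    then have "0 < f x - y" by simp
    then obtain n where "inverse (real (Suc n)) < f x - y" using reals_Archimedean by blast
    then show "x \<in> (\<Union>n. {x. y + 1 / real (Suc n) \<le> f x})" by (auto simp: inverse_eq_divide intro!: exI[of _ n])
  next
    fix x assume "x \<in> (\<Union>n. {x. y + 1 / real (Suc n) \<le> f x})"
    then obtain n where "y + 1 / real (Suc n) \<le> f x" by auto
    moreover have "0 < 1 / real (Suc n)" by simp
    ultimately show "x \<in> {x. y < f x}" unfolding mem_Collect_eq by linarith
  qed
  moreover have "incseq (\<lambda>n. {x. y + 1 / real (Suc n) \<le> f x})"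
  proof (intro incseq_SucI subsetI)
    fix n x assume "x \<in> {x. y + 1 / real (Suc n) \<le> f x}"
    moreover have "1 / real (Suc (Suc n)) \<le> 1 / real (Suc n)" by (intro divide_left_mono) auto
    ultimately show "x \<in> {x. y + 1 / real (Suc (Suc n)) \<le> f x}" unfolding mem_Collect_eq by linarith
  qed
  moreover have "range (\<lambda>n. {x. y + 1 / real (Suc n) \<le> f x}) \<subseteq> sets lborel"
    by (auto intro: superlevel_sets)
  ultimately show ?thesis by (simp add: SUP_emeasure_incseq)
qed

text \<open>The image of Lebesgue measure under \<open>f\<close> may have infinite mass near 0.
  Restricted to \<open>{x. c n \<le> f x}\<close> it is finite and determined by its values on open
  half-lines, which agree for \<open>f\<close> and \<open>u\<close>. As \<open>c n\<close> tends to
  0 the integrals increase to the full ones, because \<open>\<psi>\<close> vanishes at 0.\<close>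

lemma nn_integral_equimeasurable:
  fixes f u :: "'a::euclidean_space \<Rightarrow> real" and \<psi> :: "real \<Rightarrow> ennreal"
  assumes [measurable]: "f \<in> borel_measurable borel" "u \<in> borel_measurable borel" "\<psi> \<in> borel_measurable borel"
    and nonneg: "\<And>x. 0 \<le> f x" "\<And>x. 0 \<le> u x" and \<psi>: "\<psi> 0 = 0"
    and fin: "\<And>l. 0 < l \<Longrightarrow> emeasure lborel {x. l \<le> f x} < \<infinity>"
    and eq: "\<And>l. 0 < l \<Longrightarrow> emeasure lborel {x. l \<le> u x} = emeasure lborel {x. l \<le> f x}"
  shows "(\<integral>\<^sup>+x. \<psi> (u x) \<partial>lborel) = (\<integral>\<^sup>+x. \<psi> (f x) \<partial>lborel)"
proof -
  define c where "c n = 1 / real (Suc n)" for n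
  have c: "0 < c n" for n by (simp add: c_def)
  define \<mu> where "\<mu> f n = distr (density lborel (indicator {x. c n \<le> f x})) borel f" for f :: "'a \<Rightarrow> real" and n
  have em: "emeasure (\<mu> f n) {y<..} = (if y < c n then emeasure lborel {x. c n \<le> f x} else emeasure lborel {x. y < f x})"
    if [measurable]: "f \<in> borel_measurable borel" for f :: "'a \<Rightarrow> real" and n y
  proof -
    have [measurable]: "{x. y < f x} \<in> sets borel"
    proof -
      have "{x \<in> space borel. y < f x} \<in> sets borel" by measurable
      then show ?thesis by simp
    qed
    have "emeasure (\<mu> f n) {y<..} = emeasure (density lborel (indicator {x. c n \<le> f x})) {x. y < f x}"
      unfolding \<mu>_def by (subst emeasure_distr) (auto simp: vimage_def)
    also have "\<dots> = (\<integral>\<^sup>+x. indicator {x. c n \<le> f x} x * indicator {x. y < f x} x \<partial>lborel)"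
      by (rule emeasure_density) auto
    also have "\<dots> = (\<integral>\<^sup>+x. indicator (if y < c n then {x. c n \<le> f x} else {x. y < f x}) x \<partial>lborel)"
      by (intro nn_integral_cong) (auto simp: indicator_def)
    also have "\<dots> = emeasure lborel (if y < c n then {x. c n \<le> f x} else {x. y < f x})"
      by (rule nn_integral_indicator) auto
    finally show ?thesis by simp
  qed
  have "\<mu> u n = \<mu> f n" for n
  proof (rule measure_eqI_lessThan)
    show "sets (\<mu> u n) = sets borel" "sets (\<mu> f n) = sets borel" by (auto simp: \<mu>_def)
    fix y
    have "{x. y < f x} \<subseteq> {x. c n \<le> f x}" if "c n \<le> y" using that by auto
    then have "emeasure lborel {x. y < f x} \<le> emeasure lborel {x. c n \<le> f x}" if "c n \<le> y"
      using that by (intro emeasure_mono) auto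
    moreover have strict: "emeasure lborel {x. y < u x} = emeasure lborel {x. y < f x}" if "c n \<le> y"
    proof -
      have "0 < y + 1 / real (Suc k)" for k using that c[of n] by (intro add_pos_pos) auto
      then show ?thesis unfolding emeasure_strict_superlevel[OF assms(1)] emeasure_strict_superlevel[OF assms(2)]
        by (simp only: eq)
    qed
    ultimately have "emeasure (\<mu> f n) {y<..} < \<infinity> \<and> emeasure (\<mu> u n) {y<..} = emeasure (\<mu> f n) {y<..}"
      using fin[OF c[of n]] by (auto simp: em eq c intro: le_less_trans)
    then show "emeasure (\<mu> u n) {y<..} < \<infinity>" "emeasure (\<mu> u n) {y<..} = emeasure (\<mu> f n) {y<..}" by auto
  qed
  moreover have int: "(\<integral>\<^sup>+x. \<psi> x \<partial>\<mu> f n) = (\<integral>\<^sup>+x. indicator {x. c n \<le> f x} x * \<psi> (f x) \<partial>lborel)"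
    if [measurable]: "f \<in> borel_measurable borel" for f n
    unfolding \<mu>_def by (subst nn_integral_distr) (auto simp: nn_integral_density)
  moreover have lim: "(\<lambda>n. \<integral>\<^sup>+x. indicator {x. c n \<le> f x} x * \<psi> (f x) \<partial>lborel) \<longlonglongrightarrow> (\<integral>\<^sup>+x. \<psi> (f x) \<partial>lborel)"
    if [measurable]: "f \<in> borel_measurable borel" and nonneg: "\<And>x. 0 \<le> f x" for f :: "'a \<Rightarrow> real"
  proof (rule nn_integral_LIMSEQ)
    have "c (Suc n) \<le> c n" for n by (auto simp: c_def intro!: divide_left_mono)
    then show "incseq (\<lambda>n x. indicator {x. c n \<le> f x} x * \<psi> (f x))"
      by (intro incseq_SucI le_funI mult_right_mono) (auto simp: indicator_def intro: order_trans)
    fix x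
    show "(\<lambda>n. indicator {x. c n \<le> f x} x * \<psi> (f x)) \<longlonglongrightarrow> \<psi> (f x)"
    proof (cases "f x = 0")
      case True
      then show ?thesis by (simp add: \<psi>)
    next
      case False
      then have "0 < f x" using nonneg[of x] by simp
      then obtain m where m: "inverse (real (Suc m)) < f x" using reals_Archimedean by blast
      have "\<forall>\<^sub>F n in sequentially. indicator {x. c n \<le> f x} x * \<psi> (f x) = \<psi> (f x)"
      proof (rule eventually_sequentiallyI)
        fix n assume "m \<le> n"
        then have "c n \<le> c m" by (auto simp: c_def intro!: divide_left_mono)
        then show "indicator {x. c n \<le> f x} x * \<psi> (f x) = \<psi> (f x)"
          using m by (auto simp: c_def inverse_eq_divide indicator_def)
      qed
      then show ?thesis by (rule tendsto_eventually)
    qed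
  qed measurable
  ultimately have "(\<lambda>n. \<integral>\<^sup>+x. indicator {x. c n \<le> f x} x * \<psi> (f x) \<partial>lborel) \<longlonglongrightarrow> (\<integral>\<^sup>+x. \<psi> (u x) \<partial>lborel)"
    using lim[OF assms(2) nonneg(2)] by (simp only: int[OF assms(1), symmetric] int[OF assms(2), symmetric])
  then show ?thesis
    using lim[OF assms(1) nonneg(1)] by (rule LIMSEQ_unique)
qed

text \<open>The functions are exchanged one at a time with the other variable frozen. Vanishing of
  \<open>\<psi>\<close> on both axes supplies the condition at 0 for each frozen value.\<close>

lemma nn_integral_equimeasurable2:
  fixes f g u v :: "'a::euclidean_space \<Rightarrow> real" and \<psi> :: "real \<Rightarrow> real \<Rightarrow> ennreal"
  assumes fu: "ball_rearrangement f u" and gv: "ball_rearrangement g v"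
    and [measurable]: "(\<lambda>(x, y). \<psi> x y) \<in> borel_measurable (borel \<Otimes>\<^sub>M borel)"
    and \<psi>: "\<And>x. \<psi> x 0 = 0" "\<And>y. \<psi> 0 y = 0"
  shows "(\<integral>\<^sup>+s. \<integral>\<^sup>+t. \<psi> (u s) (v t) \<partial>lborel \<partial>lborel) = (\<integral>\<^sup>+s. \<integral>\<^sup>+t. \<psi> (f s) (g t) \<partial>lborel \<partial>lborel)"
proof -
  note [measurable] = ball_rearrangementD(1,2)[OF fu] ball_rearrangementD(1,2)[OF gv]
  have "(\<integral>\<^sup>+t. \<psi> x (v t) \<partial>lborel) = (\<integral>\<^sup>+t. \<psi> x (g t) \<partial>lborel)" for x
    by (rule nn_integral_equimeasurable) (use ball_rearrangementD[OF gv] \<psi> in auto)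
  then have "(\<integral>\<^sup>+s. \<integral>\<^sup>+t. \<psi> (u s) (v t) \<partial>lborel \<partial>lborel) = (\<integral>\<^sup>+s. \<integral>\<^sup>+t. \<psi> (u s) (g t) \<partial>lborel \<partial>lborel)"
    by simp
  also have "\<dots> = (\<integral>\<^sup>+t. \<integral>\<^sup>+s. \<psi> (u s) (g t) \<partial>lborel \<partial>lborel)"
    by (rule nn_integral_lborel_swap) measurable
  also have "\<dots> = (\<integral>\<^sup>+t. \<integral>\<^sup>+s. \<psi> (f s) (g t) \<partial>lborel \<partial>lborel)"
  proof (rule nn_integral_cong)
    fix t
    show "(\<integral>\<^sup>+s. \<psi> (u s) (g t) \<partial>lborel) = (\<integral>\<^sup>+s. \<psi> (f s) (g t) \<partial>lborel)"
      by (rule nn_integral_equimeasurable[where \<psi> = "\<lambda>x. \<psi> x (g t)"]) (use ball_rearrangementD[OF fu] \<psi> in auto)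
  qed
  also have "\<dots> = (\<integral>\<^sup>+s. \<integral>\<^sup>+t. \<psi> (f s) (g t) \<partial>lborel \<partial>lborel)"
    by (rule nn_integral_lborel_swap[symmetric]) measurable
  finally show ?thesis .
qed

text \<open>Any two of \<open>s\<close>, \<open>t\<close>, \<open>s + t\<close> serve as independent
  coordinates on the pairs, by a translation with one summand fixed. A function of only two of the
  three values therefore reduces to the same iterated integral.\<close>

lemma nn_integral_lborel_pairs:
  fixes f g :: "'a::euclidean_space \<Rightarrow> real" and \<psi> :: "real \<Rightarrow> real \<Rightarrow> ennreal"
  assumes [measurable]: "f \<in> borel_measurable borel" "g \<in> borel_measurable borel"
    "(\<lambda>(x, y). \<psi> x y) \<in> borel_measurable (borel \<Otimes>\<^sub>M borel)"
  shows "(\<integral>\<^sup>+p. \<psi> (f (fst p)) (g (snd p)) \<partial>lborel) = (\<integral>\<^sup>+s. \<integral>\<^sup>+t. \<psi> (f s) (g t) \<partial>lborel \<partial>lborel)"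
    and "(\<integral>\<^sup>+p. \<psi> (f (fst p)) (g (fst p + snd p)) \<partial>lborel) = (\<integral>\<^sup>+s. \<integral>\<^sup>+t. \<psi> (f s) (g t) \<partial>lborel \<partial>lborel)"
    and "(\<integral>\<^sup>+p. \<psi> (f (snd p)) (g (fst p + snd p)) \<partial>lborel) = (\<integral>\<^sup>+s. \<integral>\<^sup>+t. \<psi> (f s) (g t) \<partial>lborel \<partial>lborel)"
proof -
  have tr: "(\<integral>\<^sup>+t. \<psi> x (g (s + t)) \<partial>lborel) = (\<integral>\<^sup>+t. \<psi> x (g t) \<partial>lborel)" for x s
    by (rule nn_integral_lborel_translate[where f = "\<lambda>t. \<psi> x (g t)"]) measurable
  have "(\<lambda>p::'a\<times>'a. \<psi> (f (fst p)) (g (snd p))) \<in> borel_measurable borel"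
    unfolding borel_prod[symmetric] by measurable
  from nn_integral_lborel_pair[OF this]
  show "(\<integral>\<^sup>+p. \<psi> (f (fst p)) (g (snd p)) \<partial>lborel) = (\<integral>\<^sup>+s. \<integral>\<^sup>+t. \<psi> (f s) (g t) \<partial>lborel \<partial>lborel)"
    by simp
  have "(\<lambda>p::'a\<times>'a. \<psi> (f (fst p)) (g (fst p + snd p))) \<in> borel_measurable borel"
    unfolding borel_prod[symmetric] by measurable
  from nn_integral_lborel_pair[OF this]
  show "(\<integral>\<^sup>+p. \<psi> (f (fst p)) (g (fst p + snd p)) \<partial>lborel) = (\<integral>\<^sup>+s. \<integral>\<^sup>+t. \<psi> (f s) (g t) \<partial>lborel \<partial>lborel)"
    by (simp add: tr)
  have "(\<lambda>p::'a\<times>'a. \<psi> (f (snd p)) (g (fst p + snd p))) \<in> borel_measurable borel"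
    unfolding borel_prod[symmetric] by measurable
  from nn_integral_lborel_pair[OF this]
  have "(\<integral>\<^sup>+p. \<psi> (f (snd p)) (g (fst p + snd p)) \<partial>lborel) = (\<integral>\<^sup>+s. \<integral>\<^sup>+t. \<psi> (f t) (g (s + t)) \<partial>lborel \<partial>lborel)"
    by simp
  also have "\<dots> = (\<integral>\<^sup>+t. \<integral>\<^sup>+s. \<psi> (f t) (g (s + t)) \<partial>lborel \<partial>lborel)"
    by (rule nn_integral_lborel_swap) measurable
  also have "\<dots> = (\<integral>\<^sup>+t. \<integral>\<^sup>+s. \<psi> (f t) (g (t + s)) \<partial>lborel \<partial>lborel)"
    by (simp only: add.commute)
  finally show "(\<integral>\<^sup>+p. \<psi> (f (snd p)) (g (fst p + snd p)) \<partial>lborel) = (\<integral>\<^sup>+s. \<integral>\<^sup>+t. \<psi> (f s) (g t) \<partial>lborel \<partial>lborel)"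
    by (simp only: tr)
qed

section \<open>Signed integrals and the boundary terms\<close>

text \<open>Positive parts may have infinite integral, so the identity between positive and negative
  parts is integrated in a form without subtraction. Finiteness of the negative parts then permits
  moving terms across. The second conclusion allows repeated use.\<close>

lemma ext_integral_add:
  assumes [measurable]: "k \<in> borel_measurable M" "k' \<in> borel_measurable M"
    and fin: "(\<integral>\<^sup>+x. ennreal (- k x) \<partial>M) < \<infinity>" "(\<integral>\<^sup>+x. ennreal (- k' x) \<partial>M) < \<infinity>"
  shows "ext_integral M (\<lambda>x. k x + k' x) = ext_integral M k + ext_integral M k'"
    and "(\<integral>\<^sup>+x. ennreal (- (k x + k' x)) \<partial>M) < \<infinity>"
proof -
  define P where "P k = (\<integral>\<^sup>+x. ennreal (k x) \<partial>M)" for k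
  define N where "N k = (\<integral>\<^sup>+x. ennreal (- k x) \<partial>M)" for k
  let ?s = "\<lambda>x. k x + k' x"
  \<comment> \<open>Negative reals are sent to 0 by \<open>ennreal\<close>, so
    \<open>ennreal (- k x)\<close> is the negative part of \<open>k x\<close>.\<close>
  have max0: "ennreal a = ennreal (max 0 a)" for a
    by (cases "0 \<le> a") (simp_all add: ennreal_neg)
  have sub: "ennreal (- (a + b)) \<le> ennreal (- a) + ennreal (- b)" for a b :: real
  proof -
    have "ennreal (max 0 (- (a + b))) \<le> ennreal (max 0 (- a) + max 0 (- b))"
      by (intro ennreal_leI) linarith
    also have "\<dots> = ennreal (max 0 (- a)) + ennreal (max 0 (- b))" by (rule ennreal_plus) auto
    finally show ?thesis by (simp only: max0[symmetric])
  qed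
  have "N ?s \<le> (\<integral>\<^sup>+x. ennreal (- k x) + ennreal (- k' x) \<partial>M)"
    unfolding N_def by (intro nn_integral_mono sub)
  also have "\<dots> = N k + N k'" unfolding N_def by (rule nn_integral_add) auto
  also have "\<dots> < \<infinity>" using fin by (simp add: N_def)
  finally show Ns: "(\<integral>\<^sup>+x. ennreal (- ?s x) \<partial>M) < \<infinity>" by (simp add: N_def)
  have pt: "ennreal (a + b) + (ennreal (- a) + ennreal (- b)) = ennreal (- (a + b)) + (ennreal a + ennreal b)" for a b :: real
  proof -
    have "ennreal (max 0 (a + b)) + (ennreal (max 0 (- a)) + ennreal (max 0 (- b)))
        = ennreal (max 0 (a + b) + (max 0 (- a) + max 0 (- b)))"
      by (simp only: ennreal_plus max.cobounded1 add_nonneg_nonneg)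
    also have "max 0 (a + b) + (max 0 (- a) + max 0 (- b)) = max 0 (- (a + b)) + (max 0 a + max 0 b)"
      by linarith
    also have "ennreal \<dots> = ennreal (max 0 (- (a + b))) + (ennreal (max 0 a) + ennreal (max 0 b))"
      by (simp only: ennreal_plus max.cobounded1 add_nonneg_nonneg)
    finally show ?thesis by (simp only: max0[symmetric])
  qed
  have eq: "P ?s + (N k + N k') = N ?s + (P k + P k')"
  proof -
    have "P ?s + (N k + N k') = (\<integral>\<^sup>+x. ennreal (?s x) + (ennreal (- k x) + ennreal (- k' x)) \<partial>M)"
      unfolding P_def N_def by (simp add: nn_integral_add)
    also have "\<dots> = (\<integral>\<^sup>+x. ennreal (- ?s x) + (ennreal (k x) + ennreal (k' x)) \<partial>M)"
      by (simp only: pt)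
    also have "\<dots> = N ?s + (P k + P k')"
      unfolding P_def N_def by (simp add: nn_integral_add)
    finally show ?thesis .
  qed
  \<comment> \<open>If \<open>a1\<close> or \<open>a2\<close> is infinite, then so is
    \<open>a\<close>, because \<open>b1\<close> and \<open>b2\<close> are finite, and both sides are
    \<infinity>. Otherwise all six quantities are real.\<close>
  have real: "enn2ereal a - enn2ereal b = (enn2ereal a1 - enn2ereal b1) + (enn2ereal a2 - enn2ereal b2)"
    if "a + (b1 + b2) = b + (a1 + a2)" "b < \<infinity>" "b1 < \<infinity>" "b2 < \<infinity>" for a b a1 a2 b1 b2 :: ennreal
  proof -
    note hyps = that
    obtain rb where rb: "b = ennreal rb" "0 \<le> rb" using hyps(2) by (cases b) auto
    obtain rb1 where rb1: "b1 = ennreal rb1" "0 \<le> rb1" using hyps(3) by (cases b1) auto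
    obtain rb2 where rb2: "b2 = ennreal rb2" "0 \<le> rb2" using hyps(4) by (cases b2) auto
    show ?thesis
    proof (cases "a1 = top \<or> a2 = top")
      case True
      then have "a + (b1 + b2) = top" unfolding hyps(1) by auto
      then have "a = top" using rb1 rb2 by (simp add: ennreal_add_eq_top)
      then show ?thesis using True rb rb1 rb2
        by (cases a1; cases a2) (auto simp: enn2ereal_ennreal)
    next
      case False
      then obtain ra1 where ra1: "a1 = ennreal ra1" "0 \<le> ra1" by (cases a1) auto
      obtain ra2 where ra2: "a2 = ennreal ra2" "0 \<le> ra2" using False by (cases a2) auto
      have "a + (b1 + b2) \<noteq> top" unfolding hyps(1) using False rb by (simp add: ennreal_add_eq_top)
      then obtain ra where ra: "a = ennreal ra" "0 \<le> ra" by (cases a) auto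
      have "ennreal (ra + (rb1 + rb2)) = ennreal (rb + (ra1 + ra2))"
        using hyps(1) ra ra1 ra2 rb rb1 rb2 by simp
      then have "ra + (rb1 + rb2) = rb + (ra1 + ra2)"
        using ra ra1 ra2 rb rb1 rb2 by (subst (asm) ennreal_inj) auto
      then show ?thesis using ra ra1 ra2 rb rb1 rb2 by (simp add: enn2ereal_ennreal)
    qed
  qed
  show "ext_integral M ?s = ext_integral M k + ext_integral M k'"
    using real[OF eq] Ns fin unfolding ext_integral_def by (simp add: P_def N_def)
qed

lemma ext_integral_nonneg:
  assumes "\<And>x. 0 \<le> k x"
  shows "ext_integral M k = enn2ereal (\<integral>\<^sup>+x. ennreal (k x) \<partial>M)" "(\<integral>\<^sup>+x. ennreal (- k x) \<partial>M) < \<infinity>"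
  using assms by (simp_all add: ext_integral_def ennreal_neg zero_ennreal.rep_eq)

lemma ext_integral_Delta3_decomposition:
  fixes f g h :: "'a::euclidean_space \<Rightarrow> real"
  assumes cont: "continuous_on UNIV F"
    and zero: "F (0, 0, 0) = 0" "\<And>x. F (x, 0, 0) = 0" "\<And>y. F (0, y, 0) = 0" "\<And>z. F (0, 0, z) = 0"
    and pos: "\<And>a b c d' e e'. a \<le> b \<Longrightarrow> c \<le> d' \<Longrightarrow> e \<le> e' \<Longrightarrow> 0 \<le> Delta3 F a b c d' e e'"
    and [measurable]: "f \<in> borel_measurable borel" "g \<in> borel_measurable borel" "h \<in> borel_measurable borel"
    and nonneg: "\<And>x. 0 \<le> f x" "\<And>x. 0 \<le> g x" "\<And>x. 0 \<le> h x"
    and fin: "(\<integral>\<^sup>+p. ennreal (- F (f (fst p), g (snd p), 0)) \<partial>lborel) < \<infinity>"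
      "(\<integral>\<^sup>+p. ennreal (- F (f (fst p), 0, h (fst p + snd p))) \<partial>lborel) < \<infinity>"
      "(\<integral>\<^sup>+p. ennreal (- F (0, g (snd p), h (fst p + snd p))) \<partial>lborel) < \<infinity>"
  shows "ext_integral lborel (\<lambda>p. F (f (fst p), g (snd p), h (fst p + snd p))) =
    enn2ereal (\<integral>\<^sup>+p. ennreal (Delta3 F 0 (f (fst p)) 0 (g (snd p)) 0 (h (fst p + snd p))) \<partial>lborel)
    + (ext_integral lborel (\<lambda>p. F (f (fst p), g (snd p), 0))
      + (ext_integral lborel (\<lambda>p. F (f (fst p), 0, h (fst p + snd p)))
        + ext_integral lborel (\<lambda>p. F (0, g (snd p), h (fst p + snd p)))))"
proof -
  have F[measurable]: "F \<in> borel_measurable (borel \<Otimes>\<^sub>M (borel \<Otimes>\<^sub>M borel))"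
    using borel_measurable_continuous_onI[OF cont] by (simp add: borel_prod)
  define D where "D = (\<lambda>p. Delta3 F 0 (f (fst p)) 0 (g (snd p)) 0 (h (fst p + snd p)))"
  define B1 where "B1 = (\<lambda>p::'a\<times>'a. F (f (fst p), g (snd p), 0))"
  define B2 where "B2 = (\<lambda>p. F (f (fst p), 0, h (fst p + snd p)))"
  define B3 where "B3 = (\<lambda>p. F (0, g (snd p), h (fst p + snd p)))"
  have "(\<lambda>p::'a\<times>'a. f (fst p)) \<in> borel_measurable borel" "(\<lambda>p::'a\<times>'a. g (snd p)) \<in> borel_measurable borel"
      "(\<lambda>p::'a\<times>'a. h (fst p + snd p)) \<in> borel_measurable borel"
    unfolding borel_prod[symmetric] by measurable
  note [measurable] = this
  have [measurable]: "D \<in> borel_measurable lborel" "B1 \<in> borel_measurable lborel" "B2 \<in> borel_measurable lborel" "B3 \<in> borel_measurable lborel"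
    unfolding D_def B1_def B2_def B3_def Delta3_def by measurable
  have D: "0 \<le> D p" for p unfolding D_def by (intro pos nonneg)
  have "F (f (fst p), g (snd p), h (fst p + snd p)) = D p + (B1 p + (B2 p + B3 p))" for p
    by (simp add: D_def B1_def B2_def B3_def Delta3_def zero)
  then have "ext_integral lborel (\<lambda>p. F (f (fst p), g (snd p), h (fst p + snd p)))
    = ext_integral lborel (\<lambda>p. D p + (B1 p + (B2 p + B3 p)))" by simp
  moreover have "ext_integral lborel (\<lambda>p. D p + (B1 p + (B2 p + B3 p)))
    = ext_integral lborel D + (ext_integral lborel B1 + (ext_integral lborel B2 + ext_integral lborel B3))"
  proof -
    have fin': "(\<integral>\<^sup>+p. ennreal (- B1 p) \<partial>lborel) < \<infinity>" "(\<integral>\<^sup>+p. ennreal (- B2 p) \<partial>lborel) < \<infinity>" "(\<integral>\<^sup>+p. ennreal (- B3 p) \<partial>lborel) < \<infinity>"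
      using fin by (simp_all only: B1_def B2_def B3_def)
    \<comment> \<open>The sum is assembled from the innermost bracket outwards, each stage handing
      on a finite negative part to the next.\<close>
    have 23: "ext_integral lborel (\<lambda>p. B2 p + B3 p) = ext_integral lborel B2 + ext_integral lborel B3"
        "(\<integral>\<^sup>+p. ennreal (- (B2 p + B3 p)) \<partial>lborel) < \<infinity>"
      by (intro ext_integral_add fin'; measurable)+
    have 123: "ext_integral lborel (\<lambda>p. B1 p + (B2 p + B3 p)) = ext_integral lborel B1 + ext_integral lborel (\<lambda>p. B2 p + B3 p)"
        "(\<integral>\<^sup>+p. ennreal (- (B1 p + (B2 p + B3 p))) \<partial>lborel) < \<infinity>"
      by (intro ext_integral_add fin' 23(2); measurable)+
    have "ext_integral lborel (\<lambda>p. D p + (B1 p + (B2 p + B3 p)))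
      = ext_integral lborel D + ext_integral lborel (\<lambda>p. B1 p + (B2 p + B3 p))"
      by (intro ext_integral_add(1) 123(2) ext_integral_nonneg(2) D; measurable)
    then show ?thesis by (simp only: 123(1) 23(1))
  qed
  moreover have "ext_integral lborel D = enn2ereal (\<integral>\<^sup>+p. ennreal (D p) \<partial>lborel)"
    by (rule ext_integral_nonneg(1)[OF D])
  ultimately show ?thesis by (simp only: D_def B1_def B2_def B3_def)
qed

proposition riesz_ball_rearrangement:
  fixes f g h u v w :: "'a::euclidean_space \<Rightarrow> real"
  assumes cont: "continuous_on UNIV F"
    and zero: "F (0, 0, 0) = 0" "\<And>x. F (x, 0, 0) = 0" "\<And>y. F (0, y, 0) = 0" "\<And>z. F (0, 0, z) = 0"
    and pos: "\<And>a b c d' e e'. a \<le> b \<Longrightarrow> c \<le> d' \<Longrightarrow> e \<le> e' \<Longrightarrow> 0 \<le> Delta3 F a b c d' e e'"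
    and fu: "ball_rearrangement f u" and gv: "ball_rearrangement g v" and hw: "ball_rearrangement h w"
    and fin: "(\<integral>\<^sup>+p. ennreal (- F (f (fst p), g (snd p), 0)) \<partial>lborel) < \<infinity>"
      "(\<integral>\<^sup>+p. ennreal (- F (f (fst p), 0, h (fst p + snd p))) \<partial>lborel) < \<infinity>"
      "(\<integral>\<^sup>+p. ennreal (- F (0, g (snd p), h (fst p + snd p))) \<partial>lborel) < \<infinity>"
  shows "ext_integral lborel (\<lambda>p. F (f (fst p), g (snd p), h (fst p + snd p)))
    \<le> ext_integral lborel (\<lambda>p. F (u (fst p), v (snd p), w (fst p + snd p)))"
proof -
  note fs = ball_rearrangementD(1)[OF fu] ball_rearrangementD(1)[OF gv] ball_rearrangementD(1)[OF hw]
    ball_rearrangementD(3)[OF fu] ball_rearrangementD(3)[OF gv] ball_rearrangementD(3)[OF hw]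
  note us = ball_rearrangementD(2)[OF fu] ball_rearrangementD(2)[OF gv] ball_rearrangementD(2)[OF hw]
    ball_rearrangementD(4)[OF fu] ball_rearrangementD(4)[OF gv] ball_rearrangementD(4)[OF hw]
  note [measurable] = fs(1-3) us(1-3)
  have F[measurable]: "F \<in> borel_measurable (borel \<Otimes>\<^sub>M (borel \<Otimes>\<^sub>M borel))"
    using borel_measurable_continuous_onI[OF cont] by (simp add: borel_prod)
  \<comment> \<open>The factor \<open>\<sigma>\<close> takes the values 1 and -1, giving the
    positive and the negative part in one argument.\<close>
  have 1: "(\<integral>\<^sup>+p. ennreal (\<sigma> * F (u (fst p), v (snd p), 0)) \<partial>lborel) = (\<integral>\<^sup>+p. ennreal (\<sigma> * F (f (fst p), g (snd p), 0)) \<partial>lborel)" for \<sigma>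
  proof -
    have m: "(\<lambda>(x, y). ennreal (\<sigma> * F (x, y, 0))) \<in> borel_measurable (borel \<Otimes>\<^sub>M borel)" by measurable
    show ?thesis
      unfolding nn_integral_lborel_pairs(1)[where \<psi> = "\<lambda>x y. ennreal (\<sigma> * F (x, y, 0))", OF us(1,2) m]
        nn_integral_lborel_pairs(1)[where \<psi> = "\<lambda>x y. ennreal (\<sigma> * F (x, y, 0))", OF fs(1,2) m]
      by (rule nn_integral_equimeasurable2[OF fu gv m]) (auto simp: zero)
  qed
  have 2: "(\<integral>\<^sup>+p. ennreal (\<sigma> * F (u (fst p), 0, w (fst p + snd p))) \<partial>lborel) = (\<integral>\<^sup>+p. ennreal (\<sigma> * F (f (fst p), 0, h (fst p + snd p))) \<partial>lborel)" for \<sigma>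
  proof -
    have m: "(\<lambda>(x, y). ennreal (\<sigma> * F (x, 0, y))) \<in> borel_measurable (borel \<Otimes>\<^sub>M borel)" by measurable
    show ?thesis
      unfolding nn_integral_lborel_pairs(2)[where \<psi> = "\<lambda>x y. ennreal (\<sigma> * F (x, 0, y))", OF us(1,3) m]
        nn_integral_lborel_pairs(2)[where \<psi> = "\<lambda>x y. ennreal (\<sigma> * F (x, 0, y))", OF fs(1,3) m]
      by (rule nn_integral_equimeasurable2[OF fu hw m]) (auto simp: zero)
  qed
  have 3: "(\<integral>\<^sup>+p. ennreal (\<sigma> * F (0, v (snd p), w (fst p + snd p))) \<partial>lborel) = (\<integral>\<^sup>+p. ennreal (\<sigma> * F (0, g (snd p), h (fst p + snd p))) \<partial>lborel)" for \<sigma>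
  proof -
    have m: "(\<lambda>(x, y). ennreal (\<sigma> * F (0, x, y))) \<in> borel_measurable (borel \<Otimes>\<^sub>M borel)" by measurable
    show ?thesis
      unfolding nn_integral_lborel_pairs(3)[where \<psi> = "\<lambda>x y. ennreal (\<sigma> * F (0, x, y))", OF us(2,3) m]
        nn_integral_lborel_pairs(3)[where \<psi> = "\<lambda>x y. ennreal (\<sigma> * F (0, x, y))", OF fs(2,3) m]
      by (rule nn_integral_equimeasurable2[OF gv hw m]) (auto simp: zero)
  qed
  have ext_eq:
    "ext_integral lborel (\<lambda>p. F (u (fst p), v (snd p), 0)) = ext_integral lborel (\<lambda>p. F (f (fst p), g (snd p), 0))"
    "ext_integral lborel (\<lambda>p. F (u (fst p), 0, w (fst p + snd p))) = ext_integral lborel (\<lambda>p. F (f (fst p), 0, h (fst p + snd p)))"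
    "ext_integral lborel (\<lambda>p. F (0, v (snd p), w (fst p + snd p))) = ext_integral lborel (\<lambda>p. F (0, g (snd p), h (fst p + snd p)))"
    using 1[of 1] 1[of "-1"] 2[of 1] 2[of "-1"] 3[of 1] 3[of "-1"] by (simp_all add: ext_integral_def)
  have fin':
    "(\<integral>\<^sup>+p. ennreal (- F (u (fst p), v (snd p), 0)) \<partial>lborel) < \<infinity>"
    "(\<integral>\<^sup>+p. ennreal (- F (u (fst p), 0, w (fst p + snd p))) \<partial>lborel) < \<infinity>"
    "(\<integral>\<^sup>+p. ennreal (- F (0, v (snd p), w (fst p + snd p))) \<partial>lborel) < \<infinity>"
    using 1[of "-1"] 2[of "-1"] 3[of "-1"] fin by simp_all
  have "enn2ereal (\<integral>\<^sup>+p. ennreal (Delta3 F 0 (f (fst p)) 0 (g (snd p)) 0 (h (fst p + snd p))) \<partial>lborel)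
    \<le> enn2ereal (\<integral>\<^sup>+p. ennreal (Delta3 F 0 (u (fst p)) 0 (v (snd p)) 0 (w (fst p + snd p))) \<partial>lborel)"
    unfolding less_eq_ennreal.rep_eq[symmetric] by (rule riesz_Delta3[OF cont _ fu gv hw]) (rule pos)
  moreover note ext_integral_Delta3_decomposition[OF cont zero _ fs fin, OF pos]
    ext_integral_Delta3_decomposition[OF cont zero _ us fin', OF pos]
  ultimately show ?thesis by (simp add: ext_eq add_right_mono)
qed

section \<open>Passage from Lebesgue measurable functions and their rearrangements\<close>

text \<open>A Borel representative, cut off at 0 to be nonnegative everywhere, replaces
  \<open>f\<close> without changing its distribution function at positive levels. The rearrangement
  is that of \<open>f\<close> itself, made real-valued.\<close>

lemma exists_ball_rearrangement:
  fixes f :: "'a::euclidean_space \<Rightarrow> real"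
  assumes f: "f \<in> borel_measurable lebesgue" and nonneg: "\<And>x. 0 \<le> f x" and fin: "finite_distribution_function f"
  shows "\<exists>f'. (AE x in lborel. f x = f' x) \<and> ball_rearrangement f' (\<lambda>x. enn2real (symm_decr_rearrangement f x))"
proof -
  obtain f0 where f0: "f0 \<in> borel_measurable lborel" "AE x in lborel. f x = f0 x"
    using completion_ex_borel_measurable_real[OF f] by auto
  define f' where "f' x = max 0 (f0 x)" for x
  have [measurable]: "f' \<in> borel_measurable borel" using f0 by (auto simp: f'_def[abs_def])
  have ae: "AE x in lborel. f x = f' x" using f0(2) by eventually_elim (metis f'_def max.absorb2 nonneg)
  define S where "S = symm_decr_rearrangement f"
  have "is_symm_decr_rearrangement f S"
    unfolding S_def using f fin by (rule is_symm_decr_rearrangement_symm_decr_rearrangement)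
  then have S_open: "open {x. a < S x}" and S_mono: "norm x \<le> norm y \<Longrightarrow> S y \<le> S x"
    and S_dist: "distribution_function S l = distribution_function (\<lambda>x. ennreal (f x)) l" for a x y l
    unfolding is_symm_decr_rearrangement_def by blast+
  have [measurable]: "S \<in> borel_measurable borel" using S_open by (intro borel_measurableI_greater) auto
  define N where "N l = emeasure lborel {x. l \<le> f' x}" for l
  have N: "distribution_function (\<lambda>x. ennreal (f x)) l = N l" if "0 < l" for l
  proof -
    have "emeasure lebesgue {x. ennreal l \<le> ennreal (f x)} = emeasure lebesgue {x. l \<le> f x}"
      using nonneg that by (simp add: ennreal_le_iff)
    also have "\<dots> = emeasure lebesgue {x. l \<le> f' x}"
    proof (rule emeasure_eq_AE)
      show "AE x in lebesgue. x \<in> {x. l \<le> f x} \<longleftrightarrow> x \<in> {x. l \<le> f' x}"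
        using AE_completion[OF ae] by eventually_elim auto
      have "{x \<in> space lebesgue. l \<le> f x} \<in> sets lebesgue" using f by measurable
      then show "{x. l \<le> f x} \<in> sets lebesgue" by simp
      show "{x. l \<le> f' x} \<in> sets lebesgue" by (simp add: superlevel_sets)
    qed
    also have "\<dots> = N l" by (simp add: N_def superlevel_sets)
    finally show ?thesis by (simp add: distribution_function_def)
  qed
  have N_fin: "N l < \<infinity>" if "0 < l" for l
    unfolding N[OF that, symmetric] using fin that by (auto simp: finite_distribution_function_def)
  have S_sets[measurable]: "{x. ennreal l \<le> S x} \<in> sets borel" for l
  proof -
    have "{x \<in> space borel. ennreal l \<le> S x} \<in> sets borel" by measurable
    then show ?thesis by simp
  qed
  have S_em: "emeasure lborel {x. ennreal l \<le> S x} = N l" if "0 < l" for l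
    using S_dist[of l] N[OF that] by (simp add: distribution_function_def)
  \<comment> \<open>Since \<open>f'\<close> takes real values, its superlevel sets decrease to the
    empty set; their measures are finite and hence tend to 0. Equimeasurability transfers this bound
    to the set where \<open>S\<close> is infinite.\<close>
  have S_fin: "AE x in lborel. S x < \<infinity>"
  proof -
    have "{x \<in> space borel. S x = \<infinity>} \<in> sets borel" by measurable
    then have [measurable]: "{x. S x = \<infinity>} \<in> sets borel" by simp
    have "(\<lambda>n. emeasure lborel {x. real (Suc n) \<le> f' x}) \<longlonglongrightarrow> emeasure lborel (\<Inter>n. {x. real (Suc n) \<le> f' x})"
    proof (rule Lim_emeasure_decseq)
      show "range (\<lambda>n. {x. real (Suc n) \<le> f' x}) \<subseteq> sets lborel" by (auto intro: superlevel_sets)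
      show "decseq (\<lambda>n. {x. real (Suc n) \<le> f' x})" by (auto simp: decseq_def)
      show "emeasure lborel {x. real (Suc n) \<le> f' x} \<noteq> \<infinity>" for n using N_fin[of "real (Suc n)"] by (simp add: N_def)
    qed
    moreover have "(\<Inter>n. {x. real (Suc n) \<le> f' x}) = {}"
    proof (intro equals0I)
      fix x assume x: "x \<in> (\<Inter>n. {x. real (Suc n) \<le> f' x})"
      obtain n where "f' x < real n" using reals_Archimedean2 by blast
      moreover have "real (Suc n) \<le> f' x" using x by blast
      ultimately show False by simp
    qed
    ultimately have "(\<lambda>n. N (real (Suc n))) \<longlonglongrightarrow> 0" by (simp add: N_def)
    moreover have "emeasure lborel {x. S x = \<infinity>} \<le> N (real (Suc n))" for n
    proof -
      have "emeasure lborel {x. S x = \<infinity>} \<le> emeasure lborel {x. ennreal (real (Suc n)) \<le> S x}"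
        by (rule emeasure_mono) auto
      then show ?thesis using S_em[of "real (Suc n)"] by simp
    qed
    ultimately have "emeasure lborel {x. S x = \<infinity>} \<le> 0" by (intro LIMSEQ_le_const) auto
    then have "{x. S x = \<infinity>} \<in> null_sets lborel" by (intro null_setsI) auto
    from AE_not_in[OF this] show ?thesis by eventually_elim (simp add: less_top)
  qed
  have le_iff: "l \<le> enn2real (S x) \<longleftrightarrow> ennreal l \<le> S x" if "S x < \<infinity>" "0 < l" for l x
    using that by (cases "S x") (auto simp: ennreal_le_iff)
  have "ball_rearrangement f' (\<lambda>x. enn2real (S x))"
    unfolding ball_rearrangement_def
  proof (intro conjI allI impI)
    fix l :: real assume l: "0 < l"
    show "emeasure lborel {x. l \<le> f' x} < \<infinity>" using N_fin[OF l] by (simp add: N_def)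
    have "emeasure lborel {x. l \<le> enn2real (S x)} = emeasure lborel {x. ennreal l \<le> S x}"
    proof (rule emeasure_eq_AE)
      show "AE x in lborel. x \<in> {x. l \<le> enn2real (S x)} \<longleftrightarrow> x \<in> {x. ennreal l \<le> S x}"
        using S_fin by eventually_elim (simp only: mem_Collect_eq le_iff[OF _ l])
    qed (auto intro!: superlevel_sets)
    then show "emeasure lborel {x. l \<le> enn2real (S x)} = emeasure lborel {x. l \<le> f' x}"
      using S_em[OF l] by (simp add: N_def)
    obtain r where r: "0 \<le> r" "emeasure lborel (ball (0::'a) r) = N l"
      using exists_ball_emeasure_eq[OF N_fin[OF l]] by auto
    \<comment> \<open>A point of the ball outside the superlevel set would, by radial monotonicity,
      confine that set to a ball of radius \<open>norm x\<close>. Comparing measures would give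
      \<open>r \<le> norm x\<close>.\<close>
    have "ball 0 r \<subseteq> {x. ennreal l \<le> S x}"
    proof
      fix x :: 'a assume x: "x \<in> ball 0 r"
      show "x \<in> {x. ennreal l \<le> S x}"
      proof (rule ccontr)
        assume "x \<notin> {x. ennreal l \<le> S x}"
        then have "\<not> norm x \<le> norm y" if "ennreal l \<le> S y" for y
          using S_mono[of x y] that order_trans by blast
        then have "{y. ennreal l \<le> S y} \<subseteq> ball 0 (norm x)" by (auto simp: not_le)
        then have "emeasure lborel {y. ennreal l \<le> S y} \<le> emeasure lborel (ball (0::'a) (norm x))"
          by (intro emeasure_mono) auto
        then have "emeasure lborel (ball (0::'a) r) \<le> emeasure lborel (ball (0::'a) (norm x))"
          by (simp only: S_em[OF l] r(2))
        from ball_radius_le[OF r(1) this] show False using x by simp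
      qed
    qed
    then have "AE x in lborel. x \<in> ball 0 r \<longrightarrow> l \<le> enn2real (S x)"
      using S_fin le_iff[OF _ l] by (elim eventually_mono) blast
    then show "\<exists>r\<ge>0. emeasure lborel (ball (0::'a) r) = emeasure lborel {x. l \<le> f' x} \<and>
        (AE x in lborel. x \<in> ball 0 r \<longrightarrow> l \<le> enn2real (S x))"
      using r unfolding N_def by blast
  qed (simp_all add: f'_def)
  then show ?thesis using ae unfolding S_def by blast
qed

text \<open>The Borel representatives differ from \<open>f\<close>, \<open>g\<close>,
  \<open>h\<close> on null sets, which pull back to null sets of pairs under \<open>s\<close>,
  \<open>t\<close> and \<open>s + t\<close>. All integrals of the original functions, including the
  three boundary integrals, thus equal those of the representatives.\<close>

theorem theorem13:
  fixes F :: "real \<times> real \<times> real \<Rightarrow> real"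
    and f g h :: "'a::euclidean_space \<Rightarrow> real"
  assumes "continuous_on UNIV F"
    and "F (0, 0, 0) = 0"
    and "\<And>x. F (x, 0, 0) = 0"
    and "\<And>y. F (0, y, 0) = 0"
    and "\<And>z. F (0, 0, z) = 0"
    and "\<And>a b c d' e e'. a \<le> b \<Longrightarrow> c \<le> d' \<Longrightarrow> e \<le> e' \<Longrightarrow> 0 \<le> Delta3 F a b c d' e e'"
    and "f \<in> borel_measurable lebesgue" and "\<And>x. 0 \<le> f x" and "finite_distribution_function f"
    and "g \<in> borel_measurable lebesgue" and "\<And>x. 0 \<le> g x" and "finite_distribution_function g"
    and "h \<in> borel_measurable lebesgue" and "\<And>x. 0 \<le> h x" and "finite_distribution_function h"
    and "boundary_terms_integrable_below F f g h"
  shows "ext_integral (lebesgue :: ('a \<times> 'a) measure) (\<lambda>(s, t). F (f s, g t, h (s + t)))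
    \<le> ext_integral (lebesgue :: ('a \<times> 'a) measure)
        (\<lambda>(s, t). F (enn2real (symm_decr_rearrangement f s),
                     enn2real (symm_decr_rearrangement g t),
                     enn2real (symm_decr_rearrangement h (s + t))))"
proof -
  obtain f' where f': "AE x in lborel. f x = f' x" "ball_rearrangement f' (\<lambda>x. enn2real (symm_decr_rearrangement f x))"
    using exists_ball_rearrangement[OF assms(7,8,9)] by auto
  obtain g' where g': "AE x in lborel. g x = g' x" "ball_rearrangement g' (\<lambda>x. enn2real (symm_decr_rearrangement g x))"
    using exists_ball_rearrangement[OF assms(10,11,12)] by auto
  obtain h' where h': "AE x in lborel. h x = h' x" "ball_rearrangement h' (\<lambda>x. enn2real (symm_decr_rearrangement h x))"
    using exists_ball_rearrangement[OF assms(13,14,15)] by auto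
  have ae: "AE p in lborel. f (fst p) = f' (fst p) \<and> g (snd p) = g' (snd p) \<and> h (fst p + snd p) = h' (fst p + snd p)"
    using AE_lborel_fst[OF f'(1)] AE_lborel_snd[OF g'(1)] AE_lborel_fst_plus_snd[OF h'(1)]
    by eventually_elim simp
  have cong: "(\<integral>\<^sup>+p. \<phi> (f (fst p)) (g (snd p)) (h (fst p + snd p)) \<partial>lborel)
    = (\<integral>\<^sup>+p. \<phi> (f' (fst p)) (g' (snd p)) (h' (fst p + snd p)) \<partial>lborel)" for \<phi>
    using ae by (intro nn_integral_cong_AE) (auto elim: eventually_mono)
  \<comment> \<open>Completing the measure leaves every nonnegative integral unchanged, so the
    Lebesgue and Borel versions of the signed integral agree for arbitrary \<open>k\<close>.\<close>
  have ext: "ext_integral lebesgue k = ext_integral lborel k" for k :: "'a \<times> 'a \<Rightarrow> real"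
    by (simp add: ext_integral_def nn_integral_completion)
  have fin: "(\<integral>\<^sup>+p. ennreal (- F (f' (fst p), g' (snd p), 0)) \<partial>lborel) < \<infinity>"
      "(\<integral>\<^sup>+p. ennreal (- F (f' (fst p), 0, h' (fst p + snd p))) \<partial>lborel) < \<infinity>"
      "(\<integral>\<^sup>+p. ennreal (- F (0, g' (snd p), h' (fst p + snd p))) \<partial>lborel) < \<infinity>"
    using assms(16) cong[of "\<lambda>x y z. ennreal (- F (x, y, 0))"] cong[of "\<lambda>x y z. ennreal (- F (x, 0, z))"]
      cong[of "\<lambda>x y z. ennreal (- F (0, y, z))"]
    by (simp_all add: boundary_terms_integrable_below_def nn_integral_completion case_prod_unfold)
  have "ext_integral lborel (\<lambda>p. F (f (fst p), g (snd p), h (fst p + snd p)))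
    = ext_integral lborel (\<lambda>p. F (f' (fst p), g' (snd p), h' (fst p + snd p)))"
    using cong[of "\<lambda>x y z. ennreal (F (x, y, z))"] cong[of "\<lambda>x y z. ennreal (- F (x, y, z))"]
    by (simp add: ext_integral_def)
  also have "\<dots> \<le> ext_integral lborel (\<lambda>p. F (enn2real (symm_decr_rearrangement f (fst p)),
      enn2real (symm_decr_rearrangement g (snd p)), enn2real (symm_decr_rearrangement h (fst p + snd p))))"
    by (rule riesz_ball_rearrangement[OF assms(1-5) _ f'(2) g'(2) h'(2) fin]) (rule assms(6))
  finally show ?thesis by (simp add: ext case_prod_unfold)
qed

end
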